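(* Let $X$ be a separable real Banach space. Suppose that there is a Choquet simplex $S$ such that the space $A(S)$ is infinite-dimensional and $X$ contains an isometric copy of $A(S)$ (i.e. a linear subspace of $X$ that is linearly isometric to $A(S)$). Then the dual space $X^*$ fails the $\sigma(X^*,X)$-fixed point property; that is, there exist a nonempty, convex, $\sigma(X^*,X)$-compact subset $C$ of $X^*$ and a nonexpansive mapping $T\colon C\to C$ that has no fixed point.
   Context: All Banach spaces are real. $\sigma(X^*,X)$ denotes the weak$^*$ topology on $X^*$ induced by $X$. A mapping $T\colon C\to C$ on a subset $C$ of $X^*$ is nonexpansive if $\|T(x)-T(y)\|\le\|x-y\|$ for all $x,y\in C$. The space $X^*$ has the weak$^*$ fixed point property ($\sigma(X^*,X)$-FPP) if for every nonempty, convex, $\sigma(X^*,X)$-compact subset $C$ of $X^*$, every nonexpansive mapping $T\colon C\to C$ has a fixed point. For a Choquet simplex $S$ (a compact convex subset of a Hausdorff locally convex space in which every point is represented by a unique maximal probability measure), $A(S)$ denotes the Banach space of all real continuous affine functions on $S$ with the supremum norm. *)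

theory Defs
  imports "HOL-Analysis.Analysis" "HOL-Probability.Probability_Measure"
begin

text \<open>The last conjunct below is convexity of \<open>V\<close>, written out because the constant
  \<open>convex\<close> is not available inside a class declaration.\<close>

class t2_locally_convex_space = real_vector + topological_ab_group_add + t2_space +
  assumes tendsto_scaleR_Pair:
      "LIM z (nhds c \<times>\<^sub>F nhds a). fst z *\<^sub>R snd z :> nhds (c *\<^sub>R a)"
    and convex_nhd_base_zero:
      "open U \<Longrightarrow> 0 \<in> U \<Longrightarrow> \<exists>V. open V \<and> 0 \<in> V \<and> V \<subseteq> U \<and>
         (\<forall>x\<in>V. \<forall>y\<in>V. \<forall>u\<ge>0. \<forall>v\<ge>0. u + v = 1 \<longrightarrow> u *\<^sub>R x + v *\<^sub>R y \<in> V)"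

instance real_normed_vector \<subseteq> t2_locally_convex_space
proof
  fix c :: real and a :: 'a
  show "LIM z (nhds c \<times>\<^sub>F nhds a). fst z *\<^sub>R snd z :> nhds (c *\<^sub>R a)"
    unfolding nhds_prod[symmetric]
    using tendsto_fst[OF filterlim_ident, of "(c, a)"] tendsto_snd[OF filterlim_ident, of "(c, a)"]
    by (simp add: tendsto_scaleR)
next
  fix U :: "'a set"
  assume "open U" "0 \<in> U"
  then obtain e where "e > 0" "ball 0 e \<subseteq> U"
    by (meson open_contains_ball)
  then show "\<exists>V. open V \<and> 0 \<in> V \<and> V \<subseteq> U \<and>
      (\<forall>x\<in>V. \<forall>y\<in>V. \<forall>u\<ge>0. \<forall>v\<ge>0. u + v = 1 \<longrightarrow> u *\<^sub>R x + v *\<^sub>R y \<in> V)"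
    using convex_ball[of "0::'a" e] unfolding convex_def
    by (intro exI[of _ "ball 0 e"]) simp
qed

text \<open>A function on \<open>S\<close> is represented by its extension by zero to the whole type, so that
  equality in \<open>affine_functions S\<close> is equality on \<open>S\<close>, and the vector space operations
  are the pointwise ones.\<close>

definition affine_functions :: "'b::t2_locally_convex_space set \<Rightarrow> ('b \<Rightarrow> real) set" where
  "affine_functions S = {f. continuous_on S f \<and>
     (\<forall>x\<in>S. \<forall>y\<in>S. \<forall>t. 0 \<le> t \<and> t \<le> 1 \<longrightarrow>
        f ((1 - t) *\<^sub>R x + t *\<^sub>R y) = (1 - t) * f x + t * f y) \<and>
     (\<forall>x. x \<notin> S \<longrightarrow> f x = 0)}"

definition sup_norm_on :: "'b set \<Rightarrow> ('b \<Rightarrow> real) \<Rightarrow> real" where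
  "sup_norm_on S f = (SUP x\<in>S. \<bar>f x\<bar>)"

definition finite_dim_affine_functions :: "'b::t2_locally_convex_space set \<Rightarrow> bool" where
  "finite_dim_affine_functions S \<longleftrightarrow>
     (\<exists>B. finite B \<and> B \<subseteq> affine_functions S \<and>
        (\<forall>f\<in>affine_functions S. \<exists>c. \<forall>x. f x = (\<Sum>b\<in>B. c b * b x)))"

definition isometric_to_affine_functions ::
    "'a::real_normed_vector set \<Rightarrow> 'b::t2_locally_convex_space set \<Rightarrow> bool" where
  "isometric_to_affine_functions Y S \<longleftrightarrow>
     (\<exists>J. bij_betw J (affine_functions S) Y \<and>
        (\<forall>f\<in>affine_functions S. \<forall>g\<in>affine_functions S. J (\<lambda>x. f x + g x) = J f + J g) \<and>
        (\<forall>c. \<forall>f\<in>affine_functions S. J (\<lambda>x. c * f x) = c *\<^sub>R J f) \<and>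
        (\<forall>f\<in>affine_functions S. norm (J f) = sup_norm_on S f))"

text \<open>Probability measures on a compact set \<open>S\<close> are regular Borel probability measures, living
  on the Borel sets of the subspace \<open>S\<close>. For finite measures on a compact Hausdorff space,
  inner regularity already implies outer regularity.\<close>

definition regular_prob_on :: "'b::t2_space set \<Rightarrow> 'b measure \<Rightarrow> bool" where
  "regular_prob_on S M \<longleftrightarrow> prob_space M \<and> sets M = sets (restrict_space borel S) \<and>
     (\<forall>A\<in>sets M. emeasure M A = (SUP K\<in>{K. compact K \<and> K \<subseteq> A}. emeasure M K))"

definition represents_point ::
    "'b::t2_locally_convex_space set \<Rightarrow> 'b measure \<Rightarrow> 'b \<Rightarrow> bool" where
  "represents_point S M x \<longleftrightarrow> (\<forall>f\<in>affine_functions S. (\<integral>y. f y \<partial>M) = f x)"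

definition choquet_le ::
    "'b::t2_locally_convex_space set \<Rightarrow> 'b measure \<Rightarrow> 'b measure \<Rightarrow> bool" where
  "choquet_le S M N \<longleftrightarrow>
     (\<forall>f. continuous_on S f \<and> convex_on S f \<longrightarrow> (\<integral>y. f y \<partial>M) \<le> (\<integral>y. f y \<partial>N))"

definition maximal_prob_on :: "'b::t2_locally_convex_space set \<Rightarrow> 'b measure \<Rightarrow> bool" where
  "maximal_prob_on S M \<longleftrightarrow> regular_prob_on S M \<and>
     (\<forall>N. regular_prob_on S N \<and> choquet_le S M N \<longrightarrow> N = M)"

definition choquet_simplex :: "'b::t2_locally_convex_space set \<Rightarrow> bool" where
  "choquet_simplex S \<longleftrightarrow> compact S \<and> convex S \<and>
     (\<forall>x\<in>S. \<exists>!M. maximal_prob_on S M \<and> represents_point S M x)"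

text \<open>For functionals, the topology of pointwise convergence on \<open>'a \<Rightarrow>\<^sub>L real\<close> is the
  weak* topology.\<close>

abbreviation weak_star_topology :: "('a::real_normed_vector \<Rightarrow>\<^sub>L real) topology" where
  "weak_star_topology \<equiv> strong_operator_topology"

definition nonexpansive_on :: "'a::real_normed_vector set \<Rightarrow> ('a \<Rightarrow> 'a) \<Rightarrow> bool" where
  "nonexpansive_on C T \<longleftrightarrow> (\<forall>x\<in>C. \<forall>y\<in>C. norm (T x - T y) \<le> norm (x - y))"

definition weak_star_fpp :: "'a::real_normed_vector itself \<Rightarrow> bool" where
  "weak_star_fpp _ \<longleftrightarrow>
     (\<forall>C :: ('a \<Rightarrow>\<^sub>L real) set. C \<noteq> {} \<and> convex C \<and> compactin weak_star_topology C \<longrightarrow>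
        (\<forall>T. T ` C \<subseteq> C \<and> nonexpansive_on C T \<longrightarrow> (\<exists>x\<in>C. T x = x)))"

end

theory Submission
  imports Defs "HOL-Library.Function_Algebras"
begin

text \<open>
  Every point \<open>s\<close> of the simplex \<open>S\<close> has a unique maximal measure \<open>\<mu>\<^sub>s\<close>. The map \<open>s \<mapsto> \<mu>\<^sub>s\<close> is
  affine, because mixtures of maximal measures are maximal, and it is nonexpansive from the dual norm
  of \<open>A(S)\<close> to total variation, because any difference \<open>s - t\<close> of norm \<open>d\<close> equals \<open>d/2 (u - v)\<close> on \<open>A(S)\<close>
  for some \<open>u, v\<close> in \<open>S\<close>. If \<open>A(S)\<close> is infinite-dimensional, \<open>S\<close> splits into infinitely many Borel sets
  \<open>B\<^sub>k\<close>, each of full measure for some \<open>\<mu>\<close> at a point \<open>e\<^sub>k\<close>; so \<open>s \<mapsto> (\<mu>\<^sub>s(B\<^sub>k))\<^sub>k\<close> maps \<open>S\<close> to the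
  positive face of the sphere of \<open>\<ell>\<^sup>1\<close>, and \<open>e\<^sub>k\<close> to the \<open>k\<close>-th unit vector.

  Let \<open>C\<close> be the set of norm-one functionals on \<open>X\<close> whose restriction to the copy of \<open>A(S)\<close> is a state,
  hence evaluation at a point of \<open>S\<close>, and let \<open>E\<^sub>k\<close> in \<open>C\<close> extend evaluation at \<open>e\<^sub>k\<close>. The map
  \<open>x \<mapsto> \<Sum>\<^sub>k \<mu>\<^sub>x(B\<^sub>k) E\<^bsub>k+1\<^esub>\<close> factors through the right shift on \<open>\<ell>\<^sup>1\<close>: it is nonexpansive on \<open>C\<close>, and
  a fixed point would have coordinates that are nondecreasing in \<open>k\<close> and sum to \<open>1\<close>.
\<close>

section \<open>Sublinear functionals\<close>

text \<open>Uniqueness of maximal representing measures enters in one way: a maximal measure that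
  can be constructed, be it a mixture or a conditional measure, is the
  \<open>maximal_measure\<close> of its barycentre. For a conditional measure, domination of the
  part is reassembled to domination of the whole. For a mixture, domination of the whole has to be
  split among the parts, and this is where a Hahn-Banach argument is needed. The pieces
  \<open>B k\<close> do not come from extreme points. They arise by cutting S again and again at
  level sets of affine functions. If finitely many pieces were left on which each affine function is
  constant up to sets null for every \<mu>_s, then f(s), the integral of f against \<mu>_s, would
  depend on finitely many constants, against infinite dimension. The map from s to \<mu>_s is only
  shown to respect finite convex combinations, while T x is an infinite one. Hence the coordinates
  of T x are not computed; a single term is split off instead, which gives one inequality for each
  coordinate of a fixed point.\<close>

lemma homogeneous_of_le:
  fixes p :: "'v::ab_group_add \<Rightarrow> real" and scl :: "real \<Rightarrow> 'v \<Rightarrow> 'v"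
  assumes vs: "vector_space scl" and V: "module.subspace scl V"
    and le: "\<And>c x. 0 < c \<Longrightarrow> x \<in> V \<Longrightarrow> p (scl c x) \<le> c * p x"
    and "0 < c" "x \<in> V"
  shows "p (scl c x) = c * p x"
proof (rule antisym)
  interpret vector_space scl by fact
  \<comment> \<open>The hypothesis is used once more, with the factor \<open>1 / c\<close> at the
    point \<open>scl c x\<close>, which yields the reverse inequality.\<close>
  have "p (scl (1 / c) (scl c x)) \<le> (1 / c) * p (scl c x)"
    using assms by (intro le) (auto intro: subspace_scale)
  with \<open>0 < c\<close> show "c * p x \<le> p (scl c x)"
    by (simp add: field_simps)
qed (use assms in auto)

text \<open>Zorn's lemma gives a minimal sublinear functional below \<open>p\<close>, and a minimal
  one is linear: strict subadditivity in some direction would allow it to be lowered.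
  \<open>V\<close> is a subspace of a type since it will also be a set of functions.\<close>

lemma linear_below_sublinear:
  fixes scl :: "real \<Rightarrow> 'v::ab_group_add \<Rightarrow> 'v" and p :: "'v \<Rightarrow> real"
  assumes vs: "vector_space scl" and V: "module.subspace scl V"
    and sub: "\<And>x y. x \<in> V \<Longrightarrow> y \<in> V \<Longrightarrow> p (x + y) \<le> p x + p y"
    and hom: "\<And>c x. 0 < c \<Longrightarrow> x \<in> V \<Longrightarrow> p (scl c x) = c * p x"
  obtains \<phi> where "\<And>x y. x \<in> V \<Longrightarrow> y \<in> V \<Longrightarrow> \<phi> (x + y) = \<phi> x + \<phi> y"
    and "\<And>c x. x \<in> V \<Longrightarrow> \<phi> (scl c x) = c * \<phi> x" and "\<And>x. x \<in> V \<Longrightarrow> \<phi> x \<le> p x"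
proof -
  interpret vector_space scl by fact
  note [intro] = subspace_add[OF V] subspace_scale[OF V] subspace_0[OF V] subspace_neg[OF V]
    subspace_diff[OF V]
  \<comment> \<open>The value 0 off \<open>V\<close> makes comparison at all arguments depend on the
    values on \<open>V\<close> alone.\<close>
  define A where "A = {q. (\<forall>x\<in>V. \<forall>y\<in>V. q (x + y) \<le> q x + q y) \<and>
    (\<forall>c>0. \<forall>x\<in>V. q (scl c x) = c * q x) \<and> (\<forall>x\<in>V. q x \<le> p x) \<and> (\<forall>x. x \<notin> V \<longrightarrow> q x = (0::real))}"
  have Asub: "q (x + y) \<le> q x + q y" if "q \<in> A" "x \<in> V" "y \<in> V" for q x y
    using that by (auto simp: A_def)
  have Ahom: "q (scl c x) = c * q x" if "q \<in> A" "x \<in> V" "c > 0" for q x c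
    using that by (auto simp: A_def)
  have Ap: "q x \<le> p x" if "q \<in> A" "x \<in> V" for q x
    using that by (auto simp: A_def)
  have Aout: "q x = 0" if "q \<in> A" "x \<notin> V" for q x
    using that by (auto simp: A_def)
  have A0: "q 0 = 0" if "q \<in> A" for q
    using Ahom[OF that subspace_0[OF V], of 2] by simp
  have Ahom0: "q (scl c x) = c * q x" if "q \<in> A" "x \<in> V" "c \<ge> 0" for q x c
    using that Ahom[of q x c] A0 by (cases "c = 0") auto
  have Alow: "- p (- x) \<le> q x" if "q \<in> A" "x \<in> V" for q x
    using Asub[OF that subspace_neg[OF V that(2)]] A0[OF that(1)]
      Ap[OF that(1) subspace_neg[OF V that(2)]] by simp
  have "\<exists>m\<in>A. \<forall>a\<in>A. (\<forall>x. a x \<le> m x) \<longrightarrow> a = m"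
  proof (rule predicate_Zorn)
    show "partial_order_on A (relation_of (\<lambda>a b. \<forall>x. b x \<le> a x) A)"
      by (auto simp: partial_order_on_def preorder_on_def refl_on_def trans_def antisym_def
          relation_of_def intro: order_trans intro!: ext antisym)
  next
    fix C assume C: "C \<in> Chains (relation_of (\<lambda>a b. \<forall>x. b x \<le> a x) A)"
    then have CA: "C \<subseteq> A"
      by (auto simp: Chains_def relation_of_def)
    have tot: "(\<forall>x. a x \<le> b x) \<or> (\<forall>x. b x \<le> a x)" if "a \<in> C" "b \<in> C" for a b
      using C that by (auto simp: Chains_def relation_of_def)
    show "\<exists>u\<in>A. \<forall>a\<in>C. \<forall>x. u x \<le> a x"
    proof (cases "C = {}")
      case True
      have "(\<lambda>x. if x \<in> V then p x else 0) \<in> A"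
        by (auto simp: A_def sub hom)
      with True show ?thesis by blast
    next
      case False
      \<comment> \<open>The infimum over the chain is finite, as \<open>- p (- x)\<close> is a
        common lower bound by subadditivity.\<close>
      define u where "u x = (if x \<in> V then INF q\<in>C. q x else 0)" for x
      have bdd: "bdd_below ((\<lambda>q. q x) ` C)" if "x \<in> V" for x
        using Alow CA that by (intro bdd_belowI2[of _ "- p (- x)"]) auto
      have ule: "u x \<le> q x" if "q \<in> C" for q x
        using that CA Aout[of q x] by (auto simp: u_def intro!: cINF_lower bdd)
      have ge: "b \<le> u x" if "x \<in> V" "\<And>q. q \<in> C \<Longrightarrow> b \<le> q x" for b x
        using that False by (auto simp: u_def intro!: cINF_greatest)
      have "u \<in> A"
        unfolding A_def
      proof (intro CollectI conjI ballI allI impI)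
        fix x y assume xy: "x \<in> V" "y \<in> V"
        \<comment> \<open>Two members of the chain are comparable, so the smaller one can serve at
          both points.\<close>
        have ub: "u (x + y) \<le> a x + b y" if ab: "a \<in> C" "b \<in> C" for a b
          using tot[OF ab]
        proof
          assume "\<forall>x. a x \<le> b x"
          then have "a y \<le> b y" by blast
          with ule[OF ab(1), of "x + y"] Asub[of a x y] xy CA ab show ?thesis by auto
        next
          assume "\<forall>x. b x \<le> a x"
          then have "b x \<le> a x" by blast
          with ule[OF ab(2), of "x + y"] Asub[of b x y] xy CA ab show ?thesis by auto
        qed
        have ua: "u (x + y) - a x \<le> u y" if "a \<in> C" for a
        proof (rule ge[OF xy(2)])
          fix b assume "b \<in> C"
          from ub[OF that this] show "u (x + y) - a x \<le> b y" by simp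
        qed
        have "u (x + y) - u y \<le> u x"
        proof (rule ge[OF xy(1)])
          fix a assume "a \<in> C"
          from ua[OF this] show "u (x + y) - u y \<le> a x" by simp
        qed
        then show "u (x + y) \<le> u x + u y" by simp
      next
        fix c :: real and x assume cx: "0 < c" "x \<in> V"
        show "u (scl c x) = c * u x"
        proof (rule homogeneous_of_le[OF vs V _ cx])
          fix c :: real and x assume cx: "0 < c" "x \<in> V"
          have "u (scl c x) / c \<le> u x"
            using cx ule[of _ "scl c x"] Ahom CA
            by (intro ge) (fastforce simp: divide_le_eq mult.commute)+
          with cx show "u (scl c x) \<le> c * u x" by (simp add: divide_le_eq mult.commute)
        qed
      next
        fix x assume "x \<in> V"
        with False ule Ap CA show "u x \<le> p x" by (meson ex_in_conv order_trans subsetD)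
      qed (simp add: u_def)
      with ule show ?thesis by blast
    qed
  qed
  then obtain m where mA: "m \<in> A" and min: "\<And>a. a \<in> A \<Longrightarrow> (\<And>x. a x \<le> m x) \<Longrightarrow> a = m"
    by blast
  note msub = Asub[OF mA] and mhom = Ahom0[OF mA] and m0 = A0[OF mA]
  have super: "m x + m v \<le> m (x + v)" if x: "x \<in> V" and v: "v \<in> V" for x v
  proof -
    \<comment> \<open>The infimum \<open>w\<close> of \<open>F x t\<close> over
      \<open>t \<ge> 0\<close> is again sublinear and lies below \<open>m\<close> by
      \<open>t = 0\<close>. Minimality gives \<open>w = m\<close>, and then \<open>t = 1\<close> is
      superadditivity.\<close>
    define F where "F x t = m (x + scl t v) - t * m v" for x t
    define w where "w x = (if x \<in> V then INF t\<in>{0..}. F x t else 0)" for x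
    have Flow: "- m (- x) \<le> F x t" if "x \<in> V" "t \<ge> 0" for x t
    proof -
      have "m ((x + scl t v) + (- x)) \<le> m (x + scl t v) + m (- x)"
        using that v by (intro msub) auto
      then show ?thesis using mhom[OF v that(2)] by (simp add: F_def)
    qed
    have wle: "w x \<le> F x t" if "x \<in> V" "t \<ge> 0" for x t
      using that Flow[OF that(1)] by (auto simp: w_def intro!: cINF_lower bdd_belowI2[of _ "- m (- x)"])
    have wge: "b \<le> w x" if "x \<in> V" "\<And>t. t \<ge> 0 \<Longrightarrow> b \<le> F x t" for b x
      using that by (auto simp: w_def intro!: cINF_greatest)
    have wm: "w x \<le> m x" for x
      using wle[of x 0] Aout[OF mA, of x] by (cases "x \<in> V") (auto simp: F_def w_def)
    have "w \<in> A"
      unfolding A_def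
    proof (intro CollectI conjI ballI allI impI)
      fix x y assume xy: "x \<in> V" "y \<in> V"
      have wF: "w (x + y) \<le> F x t + F y s" if "t \<ge> 0" "s \<ge> 0" for t s
      proof -
        have "w (x + y) \<le> F (x + y) (t + s)"
          using xy that by (intro wle) auto
        also have "\<dots> \<le> F x t + F y s"
          using msub[of "x + scl t v" "y + scl s v"] xy v
          by (auto simp: F_def algebra_simps scale_left_distrib)
        finally show ?thesis .
      qed
      have wt: "w (x + y) - F x t \<le> w y" if "t \<ge> 0" for t
      proof (rule wge[OF xy(2)])
        fix s :: real assume "s \<ge> 0"
        from wF[OF that this] show "w (x + y) - F x t \<le> F y s" by simp
      qed
      have "w (x + y) - w y \<le> w x"
      proof (rule wge[OF xy(1)])
        fix t :: real assume "t \<ge> 0"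
        from wt[OF this] show "w (x + y) - w y \<le> F x t" by simp
      qed
      then show "w (x + y) \<le> w x + w y" by simp
    next
      fix c :: real and x assume cx: "0 < c" "x \<in> V"
      show "w (scl c x) = c * w x"
      proof (rule homogeneous_of_le[OF vs V _ cx])
        fix c :: real and x assume cx: "0 < c" "x \<in> V"
        have "w (scl c x) / c \<le> w x"
        proof (rule wge)
          fix t :: real assume t: "t \<ge> 0"
          have "w (scl c x) \<le> F (scl c x) (c * t)"
            using cx t by (intro wle) auto
          also have "\<dots> = c * F x t"
            using mhom[of "x + scl t v" c] cx v by (auto simp: F_def scale_right_distrib algebra_simps)
          finally show "w (scl c x) / c \<le> F x t"
            using cx by (simp add: divide_le_eq mult.commute)
        qed (use cx in auto)
        with cx show "w (scl c x) \<le> c * w x" by (simp add: divide_le_eq mult.commute)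
      qed
    next
      fix x assume "x \<in> V"
      then show "w x \<le> p x" using wm[of x] Ap[OF mA, of x] by simp
    qed (simp add: w_def)
    then have "w = m" using min wm by blast
    then show ?thesis using wle[OF x, of 1] by (simp add: F_def)
  qed
  have madd: "m (x + y) = m x + m y" if "x \<in> V" "y \<in> V" for x y
    using super[OF that] msub[OF that] by simp
  have mneg: "m (- x) = - m x" if "x \<in> V" for x
    using madd[OF that subspace_neg[OF V that]] m0 by simp
  have "m (scl c x) = c * m x" if "x \<in> V" for c x
  proof (cases "c \<ge> 0")
    case False
    then have "m (scl (- c) x) = - c * m x" using that by (intro mhom) auto
    then show ?thesis using mneg[OF subspace_scale[OF V that, of c]] by simp
  qed (use mhom that in auto)
  then show thesis using that madd Ap[OF mA] by blast
qed

text \<open>A pair \<open>(v, r)\<close> in the convex cone \<open>G\<close> encodes the constraint \<open>r \<le> \<phi> v\<close>.\<close>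

lemma hahn_banach_cone:
  fixes scl :: "real \<Rightarrow> 'v::ab_group_add \<Rightarrow> 'v" and p :: "'v \<Rightarrow> real"
  assumes vs: "vector_space scl" and V: "module.subspace scl V"
    and sub: "\<And>x y. x \<in> V \<Longrightarrow> y \<in> V \<Longrightarrow> p (x + y) \<le> p x + p y"
    and hom: "\<And>c x. 0 < c \<Longrightarrow> x \<in> V \<Longrightarrow> p (scl c x) = c * p x"
    and G0: "(0, 0) \<in> G"
    and GV: "\<And>v r. (v, r) \<in> G \<Longrightarrow> v \<in> V"
    and Gadd: "\<And>v r w s. (v, r) \<in> G \<Longrightarrow> (w, s) \<in> G \<Longrightarrow> (v + w, r + s) \<in> G"
    and Gscl: "\<And>c v r. 0 < c \<Longrightarrow> (v, r) \<in> G \<Longrightarrow> (scl c v, c * r) \<in> G"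
    and Gp: "\<And>v r. (v, r) \<in> G \<Longrightarrow> r \<le> p v"
  obtains \<phi> where "\<And>x y. x \<in> V \<Longrightarrow> y \<in> V \<Longrightarrow> \<phi> (x + y) = \<phi> x + \<phi> y"
    and "\<And>c x. x \<in> V \<Longrightarrow> \<phi> (scl c x) = c * \<phi> x" and "\<And>x. x \<in> V \<Longrightarrow> \<phi> x \<le> p x"
    and "\<And>v r. (v, r) \<in> G \<Longrightarrow> r \<le> \<phi> v"
proof -
  interpret vector_space scl by fact
  note [intro] = subspace_add[OF V] subspace_scale[OF V] subspace_0[OF V] subspace_neg[OF V]
  have p0: "p 0 = 0"
    using hom[of 2 0] subspace_0[OF V] by simp
  define F where "F x g = p (x + fst g) - snd g" for x g
  \<comment> \<open>On \<open>V\<close>, a linear functional lies below \<open>q\<close> exactly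
    when it lies below \<open>p\<close> and satisfies every constraint in \<open>G\<close>; the
    constraint \<open>(v, r)\<close> is read off at the point \<open>- v\<close>.\<close>
  define q where "q x = (INF g\<in>G. F x g)" for x
  have Flow: "- p (- x) \<le> F x g" if "x \<in> V" "g \<in> G" for x g
  proof -
    obtain v r where g: "g = (v, r)" by force
    have "p ((x + v) + (- x)) \<le> p (x + v) + p (- x)"
      using that g GV by (intro sub) auto
    then show ?thesis using Gp[of v r] that g by (simp add: F_def)
  qed
  have qle: "q x \<le> F x g" if "x \<in> V" "g \<in> G" for x g
    using that Flow[OF that(1)] by (auto simp: q_def intro!: cINF_lower bdd_belowI2[of _ "- p (- x)"])
  have qge: "b \<le> q x" if "\<And>g. g \<in> G \<Longrightarrow> b \<le> F x g" for b x
    using that G0 by (auto simp: q_def intro!: cINF_greatest)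
  have qsub: "q (x + y) \<le> q x + q y" if xy: "x \<in> V" "y \<in> V" for x y
  proof -
    have qF: "q (x + y) \<le> F x g + F y h" if gh: "g \<in> G" "h \<in> G" for g h
    proof -
      obtain v r w s where g: "g = (v, r)" and h: "h = (w, s)" by (metis surj_pair)
      have "q (x + y) \<le> F (x + y) (v + w, r + s)"
        using xy gh g h by (intro qle Gadd) auto
      also have "\<dots> \<le> F x g + F y h"
        using sub[of "x + v" "y + w"] xy gh g h GV by (auto simp: F_def algebra_simps)
      finally show ?thesis .
    qed
    have qg: "q (x + y) - F x g \<le> q y" if "g \<in> G" for g
    proof (rule qge)
      fix h assume "h \<in> G"
      from qF[OF that this] show "q (x + y) - F x g \<le> F y h" by simp
    qed
    have "q (x + y) - q y \<le> q x"
    proof (rule qge)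
      fix g assume "g \<in> G"
      from qg[OF this] show "q (x + y) - q y \<le> F x g" by simp
    qed
    then show ?thesis by simp
  qed
  have qhom: "q (scl c x) = c * q x" if cx: "0 < c" "x \<in> V" for c x
  proof (rule homogeneous_of_le[OF vs V _ cx])
    fix c :: real and x assume cx: "0 < c" "x \<in> V"
    have "q (scl c x) / c \<le> q x"
    proof (rule qge)
      fix g assume gG: "g \<in> G"
      obtain v r where g: "g = (v, r)" by force
      have "q (scl c x) \<le> F (scl c x) (scl c v, c * r)"
        using cx gG g by (intro qle Gscl) auto
      also have "\<dots> = c * F x g"
        using hom[of c "x + v"] cx gG g GV by (auto simp: F_def scale_right_distrib algebra_simps)
      finally show "q (scl c x) / c \<le> F x g"
        using cx by (simp add: divide_le_eq mult.commute)
    qed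
    with cx show "q (scl c x) \<le> c * q x" by (simp add: divide_le_eq mult.commute)
  qed
  obtain \<phi> where \<phi>: "\<And>x y. x \<in> V \<Longrightarrow> y \<in> V \<Longrightarrow> \<phi> (x + y) = \<phi> x + \<phi> y"
    "\<And>c x. x \<in> V \<Longrightarrow> \<phi> (scl c x) = c * \<phi> x" "\<And>x. x \<in> V \<Longrightarrow> \<phi> x \<le> q x"
    using linear_below_sublinear[OF vs V qsub qhom] by metis
  have "\<phi> x \<le> p x" if "x \<in> V" for x
    using \<phi>(3)[OF that] qle[OF that G0] by (simp add: F_def)
  moreover have "r \<le> \<phi> v" if "(v, r) \<in> G" for v r
  proof -
    have v: "v \<in> V" using GV that by blast
    have "\<phi> (- v) = - \<phi> v" using \<phi>(2)[OF v, of "- 1"] by simp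
    then show ?thesis
      using \<phi>(3)[OF subspace_neg[OF V v]] qle[OF subspace_neg[OF V v] that] p0 by (simp add: F_def)
  qed
  ultimately show thesis using that \<phi> by blast
qed

section \<open>Positive functionals on bounded Borel functions\<close>

definition linear_functional_on :: "('b \<Rightarrow> real) set \<Rightarrow> (('b \<Rightarrow> real) \<Rightarrow> real) \<Rightarrow> bool" where
  "linear_functional_on V L \<longleftrightarrow> (\<forall>f\<in>V. \<forall>g\<in>V. L (\<lambda>x. f x + g x) = L f + L g) \<and>
     (\<forall>c. \<forall>f\<in>V. L (\<lambda>x. c * f x) = c * L f)"

lemma linear_functional_onD:
  assumes "linear_functional_on V L"
  shows "f \<in> V \<Longrightarrow> g \<in> V \<Longrightarrow> L (\<lambda>x. f x + g x) = L f + L g"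
    and "f \<in> V \<Longrightarrow> L (\<lambda>x. c * f x) = c * L f"
  using assms by (auto simp: linear_functional_on_def)

text \<open>The set depends on the sigma-algebra only, so functionals that come from different
  measures on \<open>S\<close> share one domain. Values off the space are arbitrary.\<close>

definition bounded_measurable :: "'b measure \<Rightarrow> ('b \<Rightarrow> real) set" where
  "bounded_measurable M = {f \<in> borel_measurable M. \<exists>C. \<forall>x\<in>space M. \<bar>f x\<bar> \<le> C}"

lemma bounded_measurableI:
  "f \<in> borel_measurable M \<Longrightarrow> (\<And>x. x \<in> space M \<Longrightarrow> \<bar>f x\<bar> \<le> C) \<Longrightarrow> f \<in> bounded_measurable M"
  by (auto simp: bounded_measurable_def)

lemma bounded_measurable_bound:
  assumes "f \<in> bounded_measurable M"
  shows "\<exists>C\<ge>0. \<forall>x\<in>space M. \<bar>f x\<bar> \<le> C"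
proof -
  obtain C where C: "\<And>x. x \<in> space M \<Longrightarrow> \<bar>f x\<bar> \<le> C"
    using assms by (auto simp: bounded_measurable_def)
  have "\<bar>f x\<bar> \<le> \<bar>C\<bar>" if "x \<in> space M" for x
    using C[OF that] by linarith
  then show ?thesis by (intro exI[of _ "\<bar>C\<bar>"]) simp
qed

lemma bounded_measurable_measurable:
  "f \<in> bounded_measurable M \<Longrightarrow> f \<in> borel_measurable M"
  by (simp add: bounded_measurable_def)

lemma bounded_measurable_const [simp]: "(\<lambda>_. c) \<in> bounded_measurable M"
  by (rule bounded_measurableI[of _ _ "\<bar>c\<bar>"]) auto

lemma bounded_measurable_indicator: "A \<in> sets M \<Longrightarrow> indicator A \<in> bounded_measurable M"
  by (rule bounded_measurableI[of _ _ 1]) (auto simp: indicator_def)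

lemma bounded_measurable_add:
  assumes f: "f \<in> bounded_measurable M" and g: "g \<in> bounded_measurable M"
  shows "(\<lambda>x. f x + g x) \<in> bounded_measurable M"
proof -
  note [measurable] = bounded_measurable_measurable[OF f] bounded_measurable_measurable[OF g]
  obtain C where C: "C \<ge> 0" "\<And>x. x \<in> space M \<Longrightarrow> \<bar>f x\<bar> \<le> C"
    using bounded_measurable_bound[OF f] by blast
  obtain D where D: "D \<ge> 0" "\<And>x. x \<in> space M \<Longrightarrow> \<bar>g x\<bar> \<le> D"
    using bounded_measurable_bound[OF g] by blast
  show ?thesis
  proof (rule bounded_measurableI)
    fix x assume "x \<in> space M"
    with C(2) D(2) show "\<bar>f x + g x\<bar> \<le> C + D"
      by (intro order_trans[OF abs_triangle_ineq] add_mono)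
  qed measurable
qed

lemma bounded_measurable_mult:
  assumes f: "f \<in> bounded_measurable M" and g: "g \<in> bounded_measurable M"
  shows "(\<lambda>x. f x * g x) \<in> bounded_measurable M"
proof -
  note [measurable] = bounded_measurable_measurable[OF f] bounded_measurable_measurable[OF g]
  obtain C where C: "C \<ge> 0" "\<And>x. x \<in> space M \<Longrightarrow> \<bar>f x\<bar> \<le> C"
    using bounded_measurable_bound[OF f] by blast
  obtain D where D: "D \<ge> 0" "\<And>x. x \<in> space M \<Longrightarrow> \<bar>g x\<bar> \<le> D"
    using bounded_measurable_bound[OF g] by blast
  show ?thesis
  proof (rule bounded_measurableI)
    fix x assume "x \<in> space M"
    with C D show "\<bar>f x * g x\<bar> \<le> C * D"
      unfolding abs_mult by (intro mult_mono) auto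
  qed measurable
qed

lemma bounded_measurable_cmult:
  "f \<in> bounded_measurable M \<Longrightarrow> (\<lambda>x. c * f x) \<in> bounded_measurable M"
  by (rule bounded_measurable_mult) auto

lemma bounded_measurable_diff:
  assumes "f \<in> bounded_measurable M" "g \<in> bounded_measurable M"
  shows "(\<lambda>x. f x - g x) \<in> bounded_measurable M"
  using bounded_measurable_add[OF assms(1) bounded_measurable_cmult[OF assms(2), of "-1"]] by simp

lemma bounded_measurable_max:
  assumes f: "f \<in> bounded_measurable M" and g: "g \<in> bounded_measurable M"
  shows "(\<lambda>x. max (f x) (g x)) \<in> bounded_measurable M"
proof -
  note [measurable] = bounded_measurable_measurable[OF f] bounded_measurable_measurable[OF g]
  obtain C where C: "C \<ge> 0" "\<And>x. x \<in> space M \<Longrightarrow> \<bar>f x\<bar> \<le> C"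
    using bounded_measurable_bound[OF f] by blast
  obtain D where D: "D \<ge> 0" "\<And>x. x \<in> space M \<Longrightarrow> \<bar>g x\<bar> \<le> D"
    using bounded_measurable_bound[OF g] by blast
  show ?thesis
  proof (rule bounded_measurableI)
    fix x assume "x \<in> space M"
    with C(2)[of x] D(2)[of x] show "\<bar>max (f x) (g x)\<bar> \<le> max C D"
      by (auto simp: max_def abs_if split: if_splits)
  qed measurable
qed

lemma bounded_measurable_sum:
  "(\<And>i. i \<in> I \<Longrightarrow> f i \<in> bounded_measurable M) \<Longrightarrow> (\<lambda>x. \<Sum>i\<in>I. f i x) \<in> bounded_measurable M"
  by (induction I rule: infinite_finite_induct) (auto intro: bounded_measurable_add)

lemma bounded_measurable_cong_sets:
  assumes "sets M = sets N" shows "bounded_measurable M = bounded_measurable N"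
  unfolding bounded_measurable_def measurable_cong_sets[OF assms refl] sets_eq_imp_space_eq[OF assms] ..

lemma (in finite_measure) integrable_bounded_measurable:
  assumes "f \<in> bounded_measurable M" shows "integrable M f"
proof -
  obtain C where "C \<ge> 0" "\<And>x. x \<in> space M \<Longrightarrow> \<bar>f x\<bar> \<le> C"
    using bounded_measurable_bound[OF assms] by blast
  then show ?thesis
    by (intro integrable_const_bound[of f C] bounded_measurable_measurable[OF assms]) auto
qed

lemma (in finite_measure) linear_functional_integral:
  "linear_functional_on (bounded_measurable M) (\<lambda>f. \<integral>x. f x \<partial>M)"
  by (auto simp: linear_functional_on_def integrable_bounded_measurable)

lemma linear_functional_on_sum:
  assumes L: "linear_functional_on (bounded_measurable M) L"
    and "\<And>i. i \<in> I \<Longrightarrow> f i \<in> bounded_measurable M"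
  shows "L (\<lambda>x. \<Sum>i\<in>I. c i * f i x) = (\<Sum>i\<in>I. c i * L (f i))"
  using assms(2)
proof (induction I rule: infinite_finite_induct)
  case (insert i I)
  have "L (\<lambda>x. c i * f i x + (\<Sum>i\<in>I. c i * f i x)) =
      L (\<lambda>x. c i * f i x) + L (\<lambda>x. \<Sum>i\<in>I. c i * f i x)"
    using insert.prems by (intro linear_functional_onD[OF L] bounded_measurable_cmult
        bounded_measurable_sum) auto
  with insert show ?case using linear_functional_onD(2)[OF L] by simp
qed (use linear_functional_onD(2)[OF L, of "\<lambda>_. 0" 0] in auto)

text \<open>Linearity makes \<open>L\<close> vanish on simple functions; these are uniformly dense,
  and the bound carries the vanishing over to uniform limits.\<close>

lemma linear_functional_eq_0:
  assumes L: "linear_functional_on (bounded_measurable M) L"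
    and bound: "\<And>f C. f \<in> bounded_measurable M \<Longrightarrow> (\<And>x. x \<in> space M \<Longrightarrow> \<bar>f x\<bar> \<le> C) \<Longrightarrow> \<bar>L f\<bar> \<le> K * C"
    and ind: "\<And>A. A \<in> sets M \<Longrightarrow> L (indicator A) = 0"
    and f: "f \<in> bounded_measurable M"
  shows "L f = 0"
proof -
  obtain C where C: "C \<ge> 0" "\<And>x. x \<in> space M \<Longrightarrow> \<bar>f x\<bar> \<le> C"
    using bounded_measurable_bound[OF f] by blast
  note [measurable] = bounded_measurable_measurable[OF f]
  have "\<bar>L f\<bar> \<le> K * (1 / real (Suc n))" for n
  proof -
    define m where "m = real (Suc n)"
    have m: "m > 0" by (simp add: m_def)
    \<comment> \<open>Rounding \<open>m * f\<close> down to integers produces a simple function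
      \<open>g\<close> within \<open>1 / m\<close> of \<open>f\<close>; only the levels in
      \<open>I\<close> occur since \<open>f\<close> is bounded by \<open>C\<close>.\<close>
    define A where "A k = {x \<in> space M. \<lfloor>m * f x\<rfloor> = k}" for k :: int
    define I where "I = {\<lfloor>- (m * C)\<rfloor>..\<lfloor>m * C\<rfloor>}"
    define g where "g x = (\<Sum>k\<in>I. (of_int k / m) * indicator (A k) x)" for x
    have A: "A k \<in> sets M" for k unfolding A_def by measurable
    have g_eq: "g x = of_int \<lfloor>m * f x\<rfloor> / m" if "x \<in> space M" for x
    proof -
      have "\<bar>m * f x\<bar> \<le> m * C" using C(2)[OF that] m by (simp add: abs_mult)
      then have "\<lfloor>m * f x\<rfloor> \<in> I" unfolding I_def by (auto intro!: floor_mono)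
      moreover have "g x = (\<Sum>k\<in>I. if k = \<lfloor>m * f x\<rfloor> then of_int k / m else 0)"
        unfolding g_def by (intro sum.cong) (auto simp: A_def that indicator_def)
      ultimately show ?thesis by (simp add: I_def)
    qed
    have gB: "g \<in> bounded_measurable M"
      unfolding g_def by (intro bounded_measurable_sum bounded_measurable_cmult
          bounded_measurable_indicator A)
    have "L g = 0"
      unfolding g_def using A ind
      by (subst linear_functional_on_sum[OF L]) (auto intro: bounded_measurable_indicator)
    have "L f = L (\<lambda>x. (f x - g x) + g x)" by simp
    also have "\<dots> = L (\<lambda>x. f x - g x)"
      using gB f \<open>L g = 0\<close>
      by (subst linear_functional_onD(1)[OF L]) (auto intro: bounded_measurable_diff)
    finally have "L f = L (\<lambda>x. f x - g x)" .
    moreover have "\<bar>f x - g x\<bar> \<le> 1 / m" if "x \<in> space M" for x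
      using g_eq[OF that] m floor_correct[of "m * f x"] of_int_floor_le[of "m * f x"]
      by (simp add: abs_le_iff field_simps; linarith)
    ultimately show ?thesis
      using bound[of "\<lambda>x. f x - g x" "1 / m"] f gB by (simp add: m_def bounded_measurable_diff)
  qed
  moreover have "(\<lambda>n. K * (1 / real (Suc n))) \<longlonglongrightarrow> K * 0"
    by (intro tendsto_mult tendsto_const LIMSEQ_Suc[OF lim_1_over_n])
  ultimately have "\<bar>L f\<bar> \<le> K * 0"
    by (intro LIMSEQ_le_const) auto
  then show ?thesis by simp
qed

lemma positive_functional_mono:
  assumes L: "linear_functional_on (bounded_measurable M) L"
    and pos: "\<And>f. f \<in> bounded_measurable M \<Longrightarrow> (\<And>x. x \<in> space M \<Longrightarrow> 0 \<le> f x) \<Longrightarrow> 0 \<le> L f"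
    and f: "f \<in> bounded_measurable M" and g: "g \<in> bounded_measurable M"
    and le: "\<And>x. x \<in> space M \<Longrightarrow> f x \<le> g x"
  shows "L f \<le> L g"
proof -
  have "L g = L (\<lambda>x. (g x - f x) + f x)" by simp
  also have "\<dots> = L (\<lambda>x. g x - f x) + L f"
    using f g by (intro linear_functional_onD[OF L] bounded_measurable_diff)
  finally show ?thesis
    using pos[OF bounded_measurable_diff[OF g f]] le by simp
qed

lemma positive_functional_bound:
  assumes L: "linear_functional_on (bounded_measurable M) L"
    and pos: "\<And>f. f \<in> bounded_measurable M \<Longrightarrow> (\<And>x. x \<in> space M \<Longrightarrow> 0 \<le> f x) \<Longrightarrow> 0 \<le> L f"
    and f: "f \<in> bounded_measurable M" and C: "\<And>x. x \<in> space M \<Longrightarrow> \<bar>f x\<bar> \<le> C"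
  shows "\<bar>L f\<bar> \<le> L (\<lambda>_. 1) * C"
proof -
  have "L (\<lambda>x. C * 1) = C * L (\<lambda>_. 1)" "L (\<lambda>x. (- C) * 1) = (- C) * L (\<lambda>_. 1)"
    by (rule linear_functional_onD(2)[OF L], simp)+
  moreover have C': "f x \<le> C * 1" "(- C) * 1 \<le> f x" if "x \<in> space M" for x
    using C[OF that] by simp_all
  moreover have "L f \<le> L (\<lambda>x. C * 1)"
    by (rule positive_functional_mono[OF L pos f bounded_measurable_const C'(1)])
  moreover have "L (\<lambda>x. (- C) * 1) \<le> L f"
    by (rule positive_functional_mono[OF L pos bounded_measurable_const f C'(2)])
  ultimately show ?thesis by (simp add: abs_le_iff algebra_simps)
qed

text \<open>Additivity on indicators together with continuity at the empty set is countable
  additivity. The functional and the integral against the resulting measure then agree on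
  indicators, hence on all bounded measurable functions.\<close>

lemma linear_functional_representation:
  assumes L: "linear_functional_on (bounded_measurable M) L"
    and pos: "\<And>f. f \<in> bounded_measurable M \<Longrightarrow> (\<And>x. x \<in> space M \<Longrightarrow> 0 \<le> f x) \<Longrightarrow> 0 \<le> L f"
    and one: "L (\<lambda>_. 1) = 1"
    and cont: "\<And>A. range A \<subseteq> sets M \<Longrightarrow> decseq A \<Longrightarrow> (\<Inter>i. A i) = {} \<Longrightarrow> (\<lambda>i. L (indicator (A i))) \<longlonglongrightarrow> 0"
  obtains P where "prob_space P" "sets P = sets M"
    "\<And>f. f \<in> bounded_measurable M \<Longrightarrow> (\<integral>x. f x \<partial>P) = L f"
proof -
  define \<nu> where "\<nu> A = ennreal (L (indicator A))" for A
  define P where "P = measure_of (space M) (sets M) \<nu>"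
  have nn: "0 \<le> L (indicator A)" if "A \<in> sets M" for A
    using that by (intro pos bounded_measurable_indicator) auto
  have L0: "L (indicator {}) = 0"
    using linear_functional_onD(2)[OF L, of "\<lambda>_. 0" 0] by (simp add: indicator_def[abs_def])
  have positive: "positive (sets M) \<nu>"
    by (simp add: positive_def \<nu>_def L0)
  have add: "additive (sets M) \<nu>"
    unfolding additive_def
  proof (intro ballI impI)
    fix A B assume AB: "A \<in> sets M" "B \<in> sets M" "A \<inter> B = {}"
    have "indicator (A \<union> B) = (\<lambda>x. indicator A x + indicator B x :: real)"
      using AB(3) by (auto simp: indicator_def fun_eq_iff)
    then have "L (indicator (A \<union> B)) = L (indicator A) + L (indicator B)"
      using linear_functional_onD(1)[OF L] AB by (simp add: bounded_measurable_indicator)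
    then show "\<nu> (A \<union> B) = \<nu> A + \<nu> B"
      using nn AB by (simp add: \<nu>_def)
  qed
  have ca: "countably_additive (sets M) \<nu>"
  proof (rule sets.empty_continuous_imp_countably_additive[OF positive add])
    fix A :: "nat \<Rightarrow> 'a set" assume "range A \<subseteq> sets M" "decseq A" "(\<Inter>i. A i) = {}"
    from tendsto_ennrealI[OF cont[OF this]] show "(\<lambda>i. \<nu> (A i)) \<longlonglongrightarrow> 0"
      by (simp add: \<nu>_def)
  qed (simp add: \<nu>_def)
  have sets: "sets P = sets M" and space: "space P = space M"
    by (simp_all add: P_def)
  have em: "emeasure P A = \<nu> A" if "A \<in> sets M" for A
    unfolding P_def by (rule emeasure_measure_of_sigma[OF sets.sigma_algebra_axioms positive ca that])
  \<comment> \<open>The two functions may differ off the space. Monotonicity only looks at the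
    space, so it gives both inequalities.\<close>
  have "L (indicator (space M)) = L (\<lambda>_. 1)"
    by (intro antisym positive_functional_mono[OF L pos] bounded_measurable_indicator) auto
  then interpret P: prob_space P
    by (intro prob_spaceI) (simp add: space em \<nu>_def one)
  have BM: "bounded_measurable P = bounded_measurable M"
    using sets by (rule bounded_measurable_cong_sets)
  have LP: "linear_functional_on (bounded_measurable M) (\<lambda>f. \<integral>x. f x \<partial>P)"
    using P.linear_functional_integral BM by simp
  have "L f - (\<integral>x. f x \<partial>P) = 0" if f: "f \<in> bounded_measurable M" for f
  \<comment> \<open>The constant 2 is one for each of the two functionals, as both are positive with
    value 1 at the constant 1.\<close>
  proof (rule linear_functional_eq_0[of M "\<lambda>f. L f - (\<integral>x. f x \<partial>P)" 2, OF _ _ _ f])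
    show "linear_functional_on (bounded_measurable M) (\<lambda>f. L f - (\<integral>x. f x \<partial>P))"
      using L LP by (auto simp: linear_functional_on_def algebra_simps)
  next
    fix f C assume f: "f \<in> bounded_measurable M" and C: "\<And>x. x \<in> space M \<Longrightarrow> \<bar>f x\<bar> \<le> C"
    have "\<bar>\<integral>x. f x \<partial>P\<bar> \<le> (\<integral>x. 1 \<partial>P) * C"
      using f C by (intro positive_functional_bound[OF LP]) (auto intro!: integral_nonneg_AE simp: space)
    moreover have "\<bar>L f\<bar> \<le> 1 * C"
      using positive_functional_bound[OF L pos f C] one by simp
    ultimately show "\<bar>L f - (\<integral>x. f x \<partial>P)\<bar> \<le> 2 * C"
      by (simp add: P.prob_space)
  next
    fix A assume A: "A \<in> sets M"
    then have "measure P A = L (indicator A)"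
      using em[OF A] nn[OF A] by (simp add: measure_def \<nu>_def)
    with A show "L (indicator A) - (\<integral>x. indicator A x \<partial>P) = 0"
      using sets sets.sets_into_space[OF A] by (simp add: space Int_absorb2)
  qed
  with that show thesis using P.prob_space_axioms sets by auto
qed

section \<open>Regular Borel probability measures on a set\<close>

definition subspace_borel :: "'b::topological_space set \<Rightarrow> 'b measure" where
  "subspace_borel S = restrict_space borel S"

lemma space_subspace_borel [simp]: "space (subspace_borel S) = S"
  by (simp add: subspace_borel_def space_restrict_space)

lemma sets_regular_prob: "regular_prob_on S M \<Longrightarrow> sets M = sets (subspace_borel S)"
  by (simp add: regular_prob_on_def subspace_borel_def)

lemma space_regular_prob: "regular_prob_on S M \<Longrightarrow> space M = S"
  using sets_eq_imp_space_eq[OF sets_regular_prob] space_subspace_borel by blast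

lemma bounded_measurable_regular_prob:
  "regular_prob_on S M \<Longrightarrow> bounded_measurable M = bounded_measurable (subspace_borel S)"
  by (rule bounded_measurable_cong_sets[OF sets_regular_prob])

lemma compact_in_subspace_borel:
  fixes K :: "'b::t2_space set"
  shows "compact K \<Longrightarrow> K \<subseteq> S \<Longrightarrow> K \<in> sets (subspace_borel S)"
  unfolding subspace_borel_def
  by (auto simp: sets_restrict_space intro!: image_eqI[of _ _ K] borel_compact)

text \<open>In this epsilon form regularity visibly passes to any measure bounded by a multiple of
  regular ones, since the exceptional set \<open>A - K\<close> can be compared directly.\<close>

lemma regular_prob_iff:
  fixes S :: "'b::t2_space set"
  shows "regular_prob_on S M \<longleftrightarrow> prob_space M \<and> sets M = sets (subspace_borel S) \<and>
    (\<forall>A\<in>sets M. \<forall>e>0. \<exists>K. compact K \<and> K \<subseteq> A \<and> measure M (A - K) < e)"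
proof (cases "prob_space M \<and> sets M = sets (subspace_borel S)")
  case True
  then interpret prob_space M by simp
  have K: "K \<in> sets M" if "compact K" "K \<subseteq> A" "A \<in> sets M" for K A
    using compact_in_subspace_borel[of K S] True that sets.sets_into_space[OF that(3)]
      sets_eq_imp_space_eq[of M "subspace_borel S"] by auto
  have "emeasure M A = (SUP K\<in>{K. compact K \<and> K \<subseteq> A}. emeasure M K) \<longleftrightarrow>
      (\<forall>e>0. \<exists>K. compact K \<and> K \<subseteq> A \<and> measure M (A - K) < e)" (is "?l = ?r") if A: "A \<in> sets M" for A
  proof
    assume eq: ?l
    show ?r
    proof (intro allI impI)
      fix e :: real assume e: "e > 0"
      show "\<exists>K. compact K \<and> K \<subseteq> A \<and> measure M (A - K) < e"
      \<comment> \<open>If the measure is not small, \<open>measure M A - e\<close> is nonnegative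
        and so is not truncated by \<open>ennreal\<close>; if it is small, the empty compact set
        will do.\<close>
      proof (cases "measure M A < e")
        case True
        then show ?thesis by (intro exI[of _ "{}"]) auto
      next
        case False
        with e have "ennreal (measure M A - e) < emeasure M A"
          by (simp add: emeasure_eq_measure ennreal_less_iff)
        then obtain K where "compact K" "K \<subseteq> A" "ennreal (measure M A - e) < emeasure M K"
          unfolding eq less_SUP_iff by auto
        moreover from this have "measure M A - e < measure M K"
          using False by (simp add: emeasure_eq_measure ennreal_less_iff)
        ultimately show ?thesis
          using K[of K A] A by (auto simp: finite_measure_Diff intro!: exI[of _ K])
      qed
    qed
  next
    assume r: ?r
    show ?l
    proof (rule antisym)
      show "emeasure M A \<le> (SUP K\<in>{K. compact K \<and> K \<subseteq> A}. emeasure M K)"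
      proof (rule ennreal_le_epsilon)
        fix e :: real assume e: "0 < e"
        with r obtain K where K': "compact K" "K \<subseteq> A" "measure M (A - K) < e" by blast
        have "emeasure M A \<le> emeasure M K + ennreal e"
          using K[of K A] K' A e by (simp add: emeasure_eq_measure finite_measure_Diff
              flip: ennreal_plus)
        also have "\<dots> \<le> (SUP K\<in>{K. compact K \<and> K \<subseteq> A}. emeasure M K) + ennreal e"
          using K' by (intro add_right_mono SUP_upper) auto
        finally show "emeasure M A \<le> (SUP K\<in>{K. compact K \<and> K \<subseteq> A}. emeasure M K) + ennreal e" .
      qed
    qed (use A in \<open>auto intro!: SUP_least emeasure_mono\<close>)
  qed
  with True show ?thesis by (simp add: regular_prob_on_def subspace_borel_def)
qed (auto simp: regular_prob_on_def subspace_borel_def)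

lemma regular_prob_eqI:
  assumes M: "regular_prob_on S M" and N: "regular_prob_on S N"
    and eq: "\<And>A. A \<in> sets (subspace_borel S) \<Longrightarrow> (\<integral>x. indicator A x \<partial>M) = (\<integral>x. indicator A x \<partial>N :: real)"
  shows "M = N"
proof (rule measure_eqI)
  interpret M: prob_space M using M by (simp add: regular_prob_on_def)
  interpret N: prob_space N using N by (simp add: regular_prob_on_def)
  show "sets M = sets N" using sets_regular_prob[OF M] sets_regular_prob[OF N] by simp
  fix A assume A: "A \<in> sets M"
  then have "A \<subseteq> S" using sets.sets_into_space[OF A] space_regular_prob[OF M] by simp
  then show "emeasure M A = emeasure N A"
    using eq[of A] A sets_regular_prob[OF M] space_regular_prob[OF M] space_regular_prob[OF N]
    by (simp add: M.emeasure_eq_measure N.emeasure_eq_measure Int_absorb2)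
qed

text \<open>Domination by two regular measures supplies what positivity alone does not: continuity
  at the empty set, and inner regularity of the representing measure. Two dominating measures are
  allowed because mixtures need them.\<close>

lemma regular_representation:
  fixes S :: "'b::t2_space set"
  assumes N1: "regular_prob_on S N1" and N2: "regular_prob_on S N2"
    and L: "linear_functional_on (bounded_measurable (subspace_borel S)) L"
    and pos: "\<And>f. f \<in> bounded_measurable (subspace_borel S) \<Longrightarrow> (\<And>x. x \<in> S \<Longrightarrow> 0 \<le> f x) \<Longrightarrow> 0 \<le> L f"
    and one: "L (\<lambda>_. 1) = 1"
    and dom: "\<And>A. A \<in> sets (subspace_borel S) \<Longrightarrow> L (indicator A) \<le> c * (measure N1 A + measure N2 A)"
  obtains P where "regular_prob_on S P"
    "\<And>f. f \<in> bounded_measurable (subspace_borel S) \<Longrightarrow> (\<integral>x. f x \<partial>P) = L f"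
proof -
  let ?B = "subspace_borel S"
  interpret N1: prob_space N1 using N1 by (simp add: regular_prob_on_def)
  interpret N2: prob_space N2 using N2 by (simp add: regular_prob_on_def)
  note sN = sets_regular_prob[OF N1] sets_regular_prob[OF N2]
  have nn: "0 \<le> L (indicator A)" if "A \<in> sets ?B" for A
    using that by (intro pos bounded_measurable_indicator) auto
  obtain P where P: "prob_space P" "sets P = sets ?B"
    "\<And>f. f \<in> bounded_measurable ?B \<Longrightarrow> (\<integral>x. f x \<partial>P) = L f"
  proof (rule linear_functional_representation[OF L _ one])
    fix f assume "f \<in> bounded_measurable ?B" "\<And>x. x \<in> space ?B \<Longrightarrow> 0 \<le> f x"
    then show "0 \<le> L f" by (intro pos) auto
  next
    fix A :: "nat \<Rightarrow> 'b set"
    assume A: "range A \<subseteq> sets ?B" "decseq A" "(\<Inter>i. A i) = {}"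
    have sub: "range A \<subseteq> sets N1" "range A \<subseteq> sets N2"
      using A(1) sN by auto
    have "(\<lambda>i. c * (measure N1 (A i) + measure N2 (A i))) \<longlonglongrightarrow> c * (measure N1 {} + measure N2 {})"
      using N1.finite_Lim_measure_decseq[OF sub(1) A(2)] N2.finite_Lim_measure_decseq[OF sub(2) A(2)]
      unfolding A(3) by (rule tendsto_mult_left[OF tendsto_add])
    then have lim: "(\<lambda>i. c * (measure N1 (A i) + measure N2 (A i))) \<longlonglongrightarrow> 0"
      by simp
    have Ai: "A i \<in> sets ?B" for i
      using A(1) by auto
    show "(\<lambda>i. L (indicator (A i))) \<longlonglongrightarrow> 0"
      by (rule tendsto_sandwich[OF _ _ tendsto_const lim]) (simp_all add: nn dom Ai)
  qed (use that in blast)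
  interpret P: prob_space P by fact
  have PA: "measure P A = L (indicator A)" if "A \<in> sets ?B" for A
    using P(3)[OF bounded_measurable_indicator[OF that]] sets.sets_into_space[OF that]
      sets_eq_imp_space_eq[OF P(2)] by (simp add: Int_absorb2)
  have "regular_prob_on S P"
    unfolding regular_prob_iff
  proof (intro conjI ballI allI impI)
    fix A and e :: real assume A: "A \<in> sets P" and e: "e > 0"
    \<comment> \<open>No sign is assumed for \<open>c\<close>, so \<open>k\<close> is a positive
      constant strictly above it; the 2 in \<open>d\<close> accounts for the two measures.\<close>
    define k where "k = \<bar>c\<bar> + 1"
    have k: "k > 0" by (simp add: k_def)
    define d where "d = e / (2 * k)"
    have d: "d > 0" using e k by (simp add: d_def)
    obtain K1 K2 where K: "compact K1" "K1 \<subseteq> A" "measure N1 (A - K1) < d"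
      "compact K2" "K2 \<subseteq> A" "measure N2 (A - K2) < d"
      using N1 N2 A d P(2) unfolding regular_prob_iff by metis
    let ?K = "K1 \<union> K2"
    have AS: "A \<subseteq> S" using sets.sets_into_space[of A ?B] A P(2) by simp
    have Ki: "K1 \<in> sets ?B" "K2 \<in> sets ?B" and AB: "A \<in> sets ?B"
      using compact_in_subspace_borel[of _ S] K AS A P(2) by auto
    have "measure N1 (A - ?K) \<le> measure N1 (A - K1)" "measure N2 (A - ?K) \<le> measure N2 (A - K2)"
      using Ki AB sN by (auto intro!: N1.finite_measure_mono N2.finite_measure_mono)
    with K have m: "measure N1 (A - ?K) + measure N2 (A - ?K) < 2 * d" by simp
    have "measure P (A - ?K) \<le> c * (measure N1 (A - ?K) + measure N2 (A - ?K))"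
      using PA[of "A - ?K"] dom[of "A - ?K"] Ki AB by auto
    also have "\<dots> \<le> \<bar>c\<bar> * (measure N1 (A - ?K) + measure N2 (A - ?K))"
      by (intro mult_right_mono) auto
    also have "\<dots> \<le> \<bar>c\<bar> * (2 * d)"
      using m by (intro mult_left_mono) auto
    also have "\<dots> < k * (2 * d)"
      using d by (simp add: k_def algebra_simps)
    also have "\<dots> = e"
      using k by (simp add: d_def)
    finally show "\<exists>K. compact K \<and> K \<subseteq> A \<and> measure P (A - K) < e"
      using K by (intro exI[of _ ?K]) auto
  qed (use P in auto)
  with P that show thesis by blast
qed

section \<open>Maximal measures\<close>

lemma continuous_bounded_measurable:
  fixes f :: "'b::t2_space \<Rightarrow> real"
  assumes "compact S" "continuous_on S f"
  shows "f \<in> bounded_measurable (subspace_borel S)"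
proof -
  have "bounded (f ` S)"
    using assms by (intro compact_imp_bounded compact_continuous_image)
  then obtain C where "\<And>x. x \<in> S \<Longrightarrow> \<bar>f x\<bar> \<le> C"
    by (auto simp: bounded_real)
  moreover have "f \<in> borel_measurable (subspace_borel S)"
    unfolding subspace_borel_def by (rule borel_measurable_continuous_on_restrict[OF assms(2)])
  ultimately show ?thesis
    by (intro bounded_measurableI[of _ _ C]) auto
qed

lemma regular_prob_integral:
  assumes "regular_prob_on S M"
  shows "linear_functional_on (bounded_measurable (subspace_borel S)) (\<lambda>f. \<integral>x. f x \<partial>M)"
    and "\<And>f g. f \<in> bounded_measurable (subspace_borel S) \<Longrightarrow> g \<in> bounded_measurable (subspace_borel S) \<Longrightarrow>
      (\<And>x. x \<in> S \<Longrightarrow> f x \<le> g x) \<Longrightarrow> (\<integral>x. f x \<partial>M) \<le> (\<integral>x. g x \<partial>M)"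
    and "\<And>f :: _ \<Rightarrow> real. (\<And>x. x \<in> S \<Longrightarrow> 0 \<le> f x) \<Longrightarrow> 0 \<le> (\<integral>x. f x \<partial>M)"
    and "\<And>c :: real. (\<integral>x. c \<partial>M) = c"
    and "\<And>A. A \<in> sets (subspace_borel S) \<Longrightarrow> (\<integral>x. indicator A x \<partial>M) = measure M A"
    and "\<And>f. f \<in> bounded_measurable (subspace_borel S) \<Longrightarrow> integrable M f"
proof -
  interpret prob_space M using assms by (simp add: regular_prob_on_def)
  note sp = space_regular_prob[OF assms] and BM = bounded_measurable_regular_prob[OF assms]
  show "linear_functional_on (bounded_measurable (subspace_borel S)) (\<lambda>f. \<integral>x. f x \<partial>M)"
    using linear_functional_integral BM by simp
  show int: "integrable M f" if "f \<in> bounded_measurable (subspace_borel S)" for f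
    using integrable_bounded_measurable[of f] BM that by simp
  show "(\<integral>x. f x \<partial>M) \<le> (\<integral>x. g x \<partial>M)" if "f \<in> bounded_measurable (subspace_borel S)"
    "g \<in> bounded_measurable (subspace_borel S)" "\<And>x. x \<in> S \<Longrightarrow> f x \<le> g x" for f g
    using that sp by (intro integral_mono int) auto
  show "0 \<le> (\<integral>x. f x \<partial>M)" if "\<And>x. x \<in> S \<Longrightarrow> 0 \<le> f x" for f :: "_ \<Rightarrow> real"
    using that sp by (intro integral_nonneg_AE AE_I2) auto
  show "(\<integral>x. c \<partial>M) = c" for c :: real
    by (simp add: prob_space)
  show "(\<integral>x. indicator A x \<partial>M) = measure M A" if "A \<in> sets (subspace_borel S)" for A
    using sets.sets_into_space[OF that] sp by (simp add: Int_absorb2)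
qed

lemma convex_on_max:
  assumes f: "convex_on S f" and g: "convex_on S g"
  shows "convex_on S (\<lambda>x. max (f x) (g x))"
  unfolding convex_on_def
proof (intro conjI ballI allI impI)
  show "convex S" using f by (simp add: convex_on_def)
  fix x y and u v :: real assume *: "x \<in> S" "y \<in> S" "0 \<le> u" "0 \<le> v" "u + v = 1"
  have "f (u *\<^sub>R x + v *\<^sub>R y) \<le> u * f x + v * f y" "g (u *\<^sub>R x + v *\<^sub>R y) \<le> u * g x + v * g y"
    using f g * by (simp_all add: convex_on_def)
  moreover have "u * f x + v * f y \<le> u * max (f x) (g x) + v * max (f y) (g y)"
    "u * g x + v * g y \<le> u * max (f x) (g x) + v * max (f y) (g y)"
    using * by (auto intro!: add_mono mult_left_mono)
  ultimately show "max (f (u *\<^sub>R x + v *\<^sub>R y)) (g (u *\<^sub>R x + v *\<^sub>R y))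
      \<le> u * max (f x) (g x) + v * max (f y) (g y)"
    by linarith
qed

text \<open>The functional is found on all bounded Borel functions, not just on the continuous ones. As it
  is dominated by \<open>N\<close>, its values on indicators are then countably additive, and no Riesz
  representation theorem is needed.\<close>

lemma choquet_dominating_split:
  fixes S :: "'b::t2_locally_convex_space set"
  assumes S: "compact S" "convex S"
    and M1: "regular_prob_on S M1" and M2: "regular_prob_on S M2" and N: "regular_prob_on S N"
    and ab: "0 < a" "0 < b" "a + b = 1"
    and dom: "\<And>f. continuous_on S f \<Longrightarrow> convex_on S f \<Longrightarrow>
      a * (\<integral>x. f x \<partial>M1) + b * (\<integral>x. f x \<partial>M2) \<le> (\<integral>x. f x \<partial>N)"
  obtains N1 N2 where "regular_prob_on S N1" "regular_prob_on S N2"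
    "choquet_le S M1 N1" "choquet_le S M2 N2"
    "\<And>f. f \<in> bounded_measurable (subspace_borel S) \<Longrightarrow>
      (\<integral>x. f x \<partial>N) = a * (\<integral>x. f x \<partial>N1) + b * (\<integral>x. f x \<partial>N2)"
proof -
  define V where "V = bounded_measurable (subspace_borel S)"
  define K where "K = {f. continuous_on S f \<and> convex_on S f}"
  define scl where "scl c f = (\<lambda>x. c * f x)" for c and f :: "'b \<Rightarrow> real"
  \<comment> \<open>A linear functional below this \<open>p\<close> takes values between 0 and the
    \<open>N\<close>-integral on functions that are nonnegative on \<open>S\<close>.\<close>
  define p where "p f = (\<integral>x. max (f x) 0 \<partial>N)" for f :: "'b \<Rightarrow> real"
  \<comment> \<open>With \<open>d = 0\<close> the constraint says that \<Phi> dominates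
    \<open>a\<close> times \<open>M1\<close> on convex functions; with \<open>c = 0\<close> it says
    that \<open>N\<close> minus \<Phi> dominates \<open>b\<close> times \<open>M2\<close> there. So
    \<Phi> and its complement will be \<open>a\<close> times \<open>N1\<close> and \<open>b\<close>
    times \<open>N2\<close>.\<close>
  define G where "G = {(\<lambda>x. c x - d x, a * (\<integral>x. c x \<partial>M1) - (\<integral>x. d x \<partial>N) + b * (\<integral>x. d x \<partial>M2)) | c d. c \<in> K \<and> d \<in> K}"
  note M1i = regular_prob_integral[OF M1, folded V_def]
    and M2i = regular_prob_integral[OF M2, folded V_def]
    and Ni = regular_prob_integral[OF N, folded V_def]
  have vs: "vector_space scl"
    by unfold_locales (auto simp: scl_def fun_eq_iff algebra_simps)
  interpret vector_space scl by (fact vs)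
  have KV: "f \<in> V" if "f \<in> K" for f
    using that continuous_bounded_measurable[OF S(1)] by (simp add: K_def V_def)
  have Kadd: "(\<lambda>x. f x + g x) \<in> K" if "f \<in> K" "g \<in> K" for f g
    using that by (auto simp: K_def intro!: continuous_intros)
  have Kscl: "(\<lambda>x. c * f x) \<in> K" if "f \<in> K" "0 < c" for f c
    using that by (auto simp: K_def intro!: continuous_intros)
  have K0: "(\<lambda>x. c) \<in> K" for c
    using S by (simp add: K_def convex_on_const)
  have Kmax: "(\<lambda>x. max (f x) (g x)) \<in> K" if "f \<in> K" "g \<in> K" for f g
    using that by (auto simp: K_def intro!: continuous_intros convex_on_max)
  note Vdiff = bounded_measurable_diff[of _ "subspace_borel S", folded V_def]
    and Vadd = bounded_measurable_add[of _ "subspace_borel S", folded V_def]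
    and Vmax = bounded_measurable_max[of _ "subspace_borel S", folded V_def]
    and Vmult = bounded_measurable_cmult[of _ "subspace_borel S", folded V_def]
  have Vconst: "(\<lambda>_. c) \<in> V" for c
    by (simp add: V_def)
  have V: "subspace V"
    using Vconst[of 0] by (intro subspaceI) (auto simp: zero_fun_def plus_fun_def scl_def Vadd Vmult)
  have psub: "p (f + g) \<le> p f + p g" if "f \<in> V" "g \<in> V" for f g
  proof -
    have "p (f + g) \<le> (\<integral>x. max (f x) 0 + max (g x) 0 \<partial>N)"
      unfolding p_def using that by (intro Ni(2) Vadd Vmax Vconst) (auto simp: plus_fun_def Vadd)
    also have "\<dots> = p f + p g"
      unfolding p_def using that by (intro linear_functional_onD[OF Ni(1)] Vmax Vconst)
    finally show ?thesis .
  qed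
  have phom: "p (scl c f) = c * p f" if "0 < c" "f \<in> V" for c f
  proof -
    have "max (c * f x) 0 = c * max (f x) 0" for x
      using that by (simp add: max_def mult_le_0_iff)
    then show ?thesis
      using linear_functional_onD(2)[OF Ni(1) Vmax[OF that(2) Vconst], of c 0]
      by (simp add: p_def scl_def)
  qed
  obtain \<Phi> where \<Phi>: "\<And>f g. f \<in> V \<Longrightarrow> g \<in> V \<Longrightarrow> \<Phi> (f + g) = \<Phi> f + \<Phi> g"
    "\<And>c f. f \<in> V \<Longrightarrow> \<Phi> (scl c f) = c * \<Phi> f" "\<And>f. f \<in> V \<Longrightarrow> \<Phi> f \<le> p f"
    "\<And>v r. (v, r) \<in> G \<Longrightarrow> r \<le> \<Phi> v"
  proof (rule hahn_banach_cone[where scl = scl and V = V and p = p and G = G, OF vs V])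
    show "p (f + g) \<le> p f + p g" if "f \<in> V" "g \<in> V" for f g
      using that by (rule psub)
    show "p (scl c f) = c * p f" if "0 < c" "f \<in> V" for c f
      using that by (rule phom)
    have "(\<lambda>x. 0) \<in> K" by (rule K0)
    then show "(0, 0) \<in> G"
      unfolding G_def by (intro CollectI exI[of _ "\<lambda>x. 0"]) (simp add: zero_fun_def)
  next
    fix v r assume "(v, r) \<in> G"
    then show "v \<in> V" by (auto simp: G_def intro: Vdiff KV)
  next
    fix v r w s assume "(v, r) \<in> G" "(w, s) \<in> G"
    then obtain c d c' d' where *: "c \<in> K" "d \<in> K" "c' \<in> K" "d' \<in> K"
      and v: "v = (\<lambda>x. c x - d x)" and w: "w = (\<lambda>x. c' x - d' x)"
      and r: "r = a * (\<integral>x. c x \<partial>M1) - (\<integral>x. d x \<partial>N) + b * (\<integral>x. d x \<partial>M2)"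
      and s: "s = a * (\<integral>x. c' x \<partial>M1) - (\<integral>x. d' x \<partial>N) + b * (\<integral>x. d' x \<partial>M2)"
      by (auto simp: G_def)
    show "(v + w, r + s) \<in> G"
      unfolding G_def
    proof (intro CollectI exI conjI)
      show "(\<lambda>x. c x + c' x) \<in> K" "(\<lambda>x. d x + d' x) \<in> K" using * by (auto intro: Kadd)
      show "(v + w, r + s) = (\<lambda>x. (c x + c' x) - (d x + d' x), a * (\<integral>x. c x + c' x \<partial>M1) -
          (\<integral>x. d x + d' x \<partial>N) + b * (\<integral>x. d x + d' x \<partial>M2))"
        using * KV by (simp add: v w r s plus_fun_def linear_functional_onD(1)[OF M1i(1)]
            linear_functional_onD(1)[OF M2i(1)] linear_functional_onD(1)[OF Ni(1)] algebra_simps)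
    qed
  next
    fix k :: real and v r assume k: "0 < k" and "(v, r) \<in> G"
    then obtain c d where *: "c \<in> K" "d \<in> K" and v: "v = (\<lambda>x. c x - d x)"
      and r: "r = a * (\<integral>x. c x \<partial>M1) - (\<integral>x. d x \<partial>N) + b * (\<integral>x. d x \<partial>M2)"
      by (auto simp: G_def)
    show "(scl k v, k * r) \<in> G"
      unfolding G_def
    proof (intro CollectI exI conjI)
      show "(\<lambda>x. k * c x) \<in> K" "(\<lambda>x. k * d x) \<in> K" using * k by (auto intro: Kscl)
      show "(scl k v, k * r) = (\<lambda>x. k * c x - k * d x, a * (\<integral>x. k * c x \<partial>M1) -
          (\<integral>x. k * d x \<partial>N) + b * (\<integral>x. k * d x \<partial>M2))"
        using * KV by (simp add: v r scl_def linear_functional_onD(2)[OF M1i(1)]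
            linear_functional_onD(2)[OF M2i(1)] linear_functional_onD(2)[OF Ni(1)] algebra_simps)
    qed
  next
    fix v r assume "(v, r) \<in> G"
    then obtain c d where *: "c \<in> K" "d \<in> K" and v: "v = (\<lambda>x. c x - d x)"
      and r: "r = a * (\<integral>x. c x \<partial>M1) - (\<integral>x. d x \<partial>N) + b * (\<integral>x. d x \<partial>M2)"
      by (auto simp: G_def)
    \<comment> \<open>The maximum is convex, lies above both \<open>c\<close> and \<open>d\<close>,
      and exceeds \<open>d\<close> by exactly the positive part of \<open>c - d\<close>; so
      \<open>dom\<close> applied to it is the required compatibility with \<open>p\<close>.\<close>
    let ?m = "\<lambda>x. max (c x) (d x)"
    have "a * (\<integral>x. c x \<partial>M1) + b * (\<integral>x. d x \<partial>M2) \<le> a * (\<integral>x. ?m x \<partial>M1) + b * (\<integral>x. ?m x \<partial>M2)"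
      using ab * by (intro add_mono mult_left_mono M1i(2) M2i(2) KV Kmax) auto
    also have "\<dots> \<le> (\<integral>x. ?m x \<partial>N)"
      using Kmax[OF *] by (intro dom) (auto simp: K_def)
    also have "\<dots> = (\<integral>x. max (c x - d x) 0 + d x \<partial>N)"
      by (intro Bochner_Integration.integral_cong) auto
    also have "\<dots> = p v + (\<integral>x. d x \<partial>N)"
      unfolding p_def v using * by (intro linear_functional_onD[OF Ni(1)] Vmax Vdiff Vconst KV)
    finally show "r \<le> p v" by (simp add: r)
  qed (rule that; blast)
  have \<Phi>lin: "linear_functional_on V \<Phi>"
    using \<Phi>(1,2) by (simp add: linear_functional_on_def scl_def plus_fun_def)
  have \<Phi>nn: "0 \<le> \<Phi> f" if "f \<in> V" "\<And>x. x \<in> S \<Longrightarrow> 0 \<le> f x" for f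
  proof -
    have "p (scl (-1) f) \<le> (\<integral>x. 0 \<partial>N)"
      unfolding p_def scl_def using that by (intro Ni(2) Vmax Vmult Vconst) auto
    moreover have "scl (-1) f \<in> V" using that(1) by (auto simp: scl_def dest: Vmult[of f "-1"])
    ultimately show ?thesis using \<Phi>(2)[OF that(1), of "-1"] \<Phi>(3)[of "scl (-1) f"] by simp
  qed
  have \<Phi>le: "\<Phi> f \<le> (\<integral>x. f x \<partial>N)" if "f \<in> V" "\<And>x. x \<in> S \<Longrightarrow> 0 \<le> f x" for f
  proof -
    have "p f \<le> (\<integral>x. f x \<partial>N)"
      unfolding p_def using that by (intro Ni(2) Vmax Vconst) auto
    with \<Phi>(3)[OF that(1)] show ?thesis by simp
  qed
  have \<Phi>K1: "a * (\<integral>x. f x \<partial>M1) \<le> \<Phi> f" if "f \<in> K" for f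
  proof -
    have "(f, a * (\<integral>x. f x \<partial>M1)) \<in> G"
      unfolding G_def using that K0[of 0]
      by (intro CollectI exI[of _ f] exI[of _ "\<lambda>x. 0"]) simp
    then show ?thesis by (rule \<Phi>)
  qed
  have \<Phi>K2: "b * (\<integral>x. f x \<partial>M2) \<le> (\<integral>x. f x \<partial>N) - \<Phi> f" if "f \<in> K" for f
  proof -
    have "(scl (-1) f, - (\<integral>x. f x \<partial>N) + b * (\<integral>x. f x \<partial>M2)) \<in> G"
      unfolding G_def using that K0[of 0]
      by (intro CollectI exI[of _ f] exI[of _ "\<lambda>x. 0"]) (simp add: scl_def)
    then have "- (\<integral>x. f x \<partial>N) + b * (\<integral>x. f x \<partial>M2) \<le> \<Phi> (scl (-1) f)" by (rule \<Phi>)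
    then show ?thesis using \<Phi>(2)[OF KV[OF that], of "-1"] by simp
  qed
  \<comment> \<open>The constant 1 gives the lower bounds \<open>a\<close> and \<open>b\<close> for
    two numbers that add up to \<open>1 = a + b\<close>, so both are equalities.\<close>
  have \<Phi>1: "\<Phi> (\<lambda>x. 1) = a"
    using \<Phi>K1[OF K0, of 1] \<Phi>K2[OF K0, of 1] ab unfolding M1i(4) M2i(4) Ni(4) by simp
  have indV: "(indicator A :: 'b \<Rightarrow> real) \<in> V" if "A \<in> sets (subspace_borel S)" for A
    unfolding V_def by (rule bounded_measurable_indicator[OF that])
  obtain N1 where N1: "regular_prob_on S N1" "\<And>f. f \<in> V \<Longrightarrow> (\<integral>x. f x \<partial>N1) = \<Phi> f / a"
  \<comment> \<open>One dominating measure is enough here, so \<open>N\<close> fills both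
    places.\<close>
  proof (rule regular_representation[OF N N, of "\<lambda>f. \<Phi> f / a" "1 / a", folded V_def])
    show "linear_functional_on V (\<lambda>f. \<Phi> f / a)"
      using \<Phi>lin by (auto simp: linear_functional_on_def add_divide_distrib)
    show "\<Phi> (indicator A) / a \<le> 1 / a * (measure N A + measure N A)" if A: "A \<in> sets (subspace_borel S)" for A
    proof -
      have "\<Phi> (indicator A) \<le> measure N A + measure N A"
        using \<Phi>le[OF indV[OF A] indicator_pos_le] Ni(5)[OF A] measure_nonneg[of N A] by linarith
      then show ?thesis using ab by (simp add: divide_right_mono)
    qed
  qed (use that ab \<Phi>nn \<Phi>1 in auto)
  obtain N2 where N2: "regular_prob_on S N2" "\<And>f. f \<in> V \<Longrightarrow> (\<integral>x. f x \<partial>N2) = ((\<integral>x. f x \<partial>N) - \<Phi> f) / b"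
  proof (rule regular_representation[OF N N, of "\<lambda>f. ((\<integral>x. f x \<partial>N) - \<Phi> f) / b" "1 / b", folded V_def])
    show "linear_functional_on V (\<lambda>f. ((\<integral>x. f x \<partial>N) - \<Phi> f) / b)"
      using \<Phi>lin Ni(1) by (auto simp: linear_functional_on_def add_divide_distrib diff_divide_distrib algebra_simps)
    show "((\<integral>x. indicator A x \<partial>N) - \<Phi> (indicator A)) / b \<le> 1 / b * (measure N A + measure N A)"
      if A: "A \<in> sets (subspace_borel S)" for A
    proof -
      have "(\<integral>x. indicator A x \<partial>N) - \<Phi> (indicator A) \<le> measure N A + measure N A"
        using \<Phi>nn[OF indV[OF A] indicator_pos_le] Ni(5)[OF A] measure_nonneg[of N A] by linarith
      then show ?thesis using ab by (simp add: divide_right_mono)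
    qed
    show "((\<integral>x. 1 \<partial>N) - \<Phi> (\<lambda>_. 1)) / b = 1"
      using ab \<Phi>1 Ni(4)[of 1] by (simp add: field_simps)
  qed (use that ab \<Phi>le in auto)
  show thesis
  proof (rule that[OF N1(1) N2(1)])
    show "choquet_le S M1 N1"
      unfolding choquet_le_def
    proof (intro allI impI)
      fix f assume "continuous_on S f \<and> convex_on S f"
      then have f: "f \<in> K" by (simp add: K_def)
      show "(\<integral>x. f x \<partial>M1) \<le> (\<integral>x. f x \<partial>N1)"
        using \<Phi>K1[OF f] ab by (simp add: N1(2)[OF KV[OF f]] pos_le_divide_eq mult.commute)
    qed
    show "choquet_le S M2 N2"
      unfolding choquet_le_def
    proof (intro allI impI)
      fix f assume "continuous_on S f \<and> convex_on S f"
      then have f: "f \<in> K" by (simp add: K_def)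
      show "(\<integral>x. f x \<partial>M2) \<le> (\<integral>x. f x \<partial>N2)"
        using \<Phi>K2[OF f] ab by (simp add: N2(2)[OF KV[OF f]] pos_le_divide_eq mult.commute)
    qed
    show "(\<integral>x. f x \<partial>N) = a * (\<integral>x. f x \<partial>N1) + b * (\<integral>x. f x \<partial>N2)"
      if "f \<in> bounded_measurable (subspace_borel S)" for f
      using that ab by (simp add: N1(2) N2(2) V_def)
  qed
qed

lemma regular_prob_mixture:
  fixes S :: "'b::t2_space set"
  assumes M1: "regular_prob_on S M1" and M2: "regular_prob_on S M2"
    and ab: "0 \<le> a" "0 \<le> b" "a + b = 1"
  obtains P where "regular_prob_on S P"
    "\<And>f. f \<in> bounded_measurable (subspace_borel S) \<Longrightarrow>
      (\<integral>x. f x \<partial>P) = a * (\<integral>x. f x \<partial>M1) + b * (\<integral>x. f x \<partial>M2)"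
proof (rule regular_representation[OF M1 M2, of "\<lambda>f. a * (\<integral>x. f x \<partial>M1) + b * (\<integral>x. f x \<partial>M2)" 1])
  note M1i = regular_prob_integral[OF M1] and M2i = regular_prob_integral[OF M2]
  show "linear_functional_on (bounded_measurable (subspace_borel S)) (\<lambda>f. a * (\<integral>x. f x \<partial>M1) + b * (\<integral>x. f x \<partial>M2))"
    using M1i(1) M2i(1) by (auto simp: linear_functional_on_def algebra_simps)
  show "a * (\<integral>x. indicator A x \<partial>M1) + b * (\<integral>x. indicator A x \<partial>M2) \<le> 1 * (measure M1 A + measure M2 A)"
    if A: "A \<in> sets (subspace_borel S)" for A
  proof -
    have "a * measure M1 A \<le> measure M1 A" "b * measure M2 A \<le> measure M2 A"
      using ab by (intro mult_left_le_one_le; simp)+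
    then show ?thesis unfolding M1i(5)[OF A] M2i(5)[OF A] mult_1_left by (rule add_mono)
  qed
  show "0 \<le> a * (\<integral>x. f x \<partial>M1) + b * (\<integral>x. f x \<partial>M2)" if "\<And>x. x \<in> S \<Longrightarrow> 0 \<le> f x" for f
    using ab M1i(3)[OF that] M2i(3)[OF that] by simp
  show "a * (\<integral>x. 1 \<partial>M1) + b * (\<integral>x. 1 \<partial>M2) = 1"
    using ab M1i(4)[of 1] M2i(4)[of 1] by simp
qed (use that in auto)

text \<open>A measure above the mixture splits into measures above the two components; maximality of
  the components fixes both, and with them the dominating measure.\<close>

lemma maximal_prob_mixture:
  fixes S :: "'b::t2_locally_convex_space set"
  assumes S: "compact S" "convex S"
    and M1: "maximal_prob_on S M1" and M2: "maximal_prob_on S M2"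
    and ab: "0 < a" "0 < b" "a + b = 1"
  obtains P where "maximal_prob_on S P"
    "\<And>f. f \<in> bounded_measurable (subspace_borel S) \<Longrightarrow>
      (\<integral>x. f x \<partial>P) = a * (\<integral>x. f x \<partial>M1) + b * (\<integral>x. f x \<partial>M2)"
proof -
  have R: "regular_prob_on S M1" "regular_prob_on S M2"
    using M1 M2 by (auto simp: maximal_prob_on_def)
  obtain P where P: "regular_prob_on S P" "\<And>f. f \<in> bounded_measurable (subspace_borel S) \<Longrightarrow>
      (\<integral>x. f x \<partial>P) = a * (\<integral>x. f x \<partial>M1) + b * (\<integral>x. f x \<partial>M2)"
    using regular_prob_mixture[OF R, of a b] ab by auto
  have "N = P" if N: "regular_prob_on S N" and le: "choquet_le S P N" for N
  proof -
    have "a * (\<integral>x. f x \<partial>M1) + b * (\<integral>x. f x \<partial>M2) \<le> (\<integral>x. f x \<partial>N)"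
      if "continuous_on S f" "convex_on S f" for f
      using le[unfolded choquet_le_def, rule_format, of f] that
        P(2)[OF continuous_bounded_measurable[OF S(1) that(1)]] by simp
    then obtain N1 N2 where N12: "regular_prob_on S N1" "regular_prob_on S N2"
      "choquet_le S M1 N1" "choquet_le S M2 N2"
      "\<And>f. f \<in> bounded_measurable (subspace_borel S) \<Longrightarrow>
        (\<integral>x. f x \<partial>N) = a * (\<integral>x. f x \<partial>N1) + b * (\<integral>x. f x \<partial>N2)"
      using choquet_dominating_split[OF S R N ab] by metis
    have "N1 = M1" "N2 = M2"
      using M1 M2 N12 by (auto simp: maximal_prob_on_def)
    show ?thesis
    proof (rule regular_prob_eqI[OF N P(1)])
      fix A assume "A \<in> sets (subspace_borel S)"
      note A = bounded_measurable_indicator[OF this]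
      show "(\<integral>x. indicator A x \<partial>N) = (\<integral>x. indicator A x \<partial>P :: real)"
        unfolding N12(5)[OF A] P(2)[OF A] \<open>N1 = M1\<close> \<open>N2 = M2\<close> ..
    qed
  qed
  with P that show thesis by (auto simp: maximal_prob_on_def)
qed

text \<open>\<open>P\<close> is \<open>M\<close> conditioned on \<open>B\<close>. If
  \<open>N\<close> dominates \<open>P\<close>, then exchanging the part of \<open>M\<close> on
  \<open>B\<close> for a multiple of \<open>N\<close> gives a measure above \<open>M\<close>. By
  maximality nothing has changed, so \<open>N = P\<close>.\<close>

lemma maximal_prob_conditional:
  fixes S :: "'b::t2_locally_convex_space set"
  assumes S: "compact S" and M: "maximal_prob_on S M"
    and B: "B \<in> sets (subspace_borel S)" and pos: "measure M B > 0"
  obtains P where "maximal_prob_on S P" "measure P B = 1"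
proof -
  let ?V = "bounded_measurable (subspace_borel S)"
  define m where "m = measure M B"
  have R: "regular_prob_on S M" and max: "\<And>N. regular_prob_on S N \<Longrightarrow> choquet_le S M N \<Longrightarrow> N = M"
    using M by (auto simp: maximal_prob_on_def)
  interpret M: prob_space M using R by (simp add: regular_prob_on_def)
  note Mi = regular_prob_integral[OF R]
  have sM: "sets M = sets (subspace_borel S)" by (rule sets_regular_prob[OF R])
  have m: "0 < m" "m \<le> 1" using pos by (simp_all add: m_def)
  have BM: "(\<lambda>x. indicator A x * f x) \<in> ?V" if "A \<in> sets (subspace_borel S)" "f \<in> ?V" for f A
    using that by (intro bounded_measurable_mult bounded_measurable_indicator)
  have lin: "linear_functional_on ?V (\<lambda>f. \<integral>x. indicator A x * f x \<partial>M)"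
    if A: "A \<in> sets (subspace_borel S)" for A
    unfolding linear_functional_on_def
  proof (intro conjI ballI allI)
    fix f g assume "f \<in> ?V" "g \<in> ?V"
    then show "(\<integral>x. indicator A x * (f x + g x) \<partial>M) = (\<integral>x. indicator A x * f x \<partial>M) + (\<integral>x. indicator A x * g x \<partial>M)"
      using linear_functional_onD(1)[OF Mi(1) BM[OF A] BM[OF A]] by (simp add: distrib_left)
  next
    fix c f assume "f \<in> ?V"
    then show "(\<integral>x. indicator A x * (c * f x) \<partial>M) = c * (\<integral>x. indicator A x * f x \<partial>M)"
      using linear_functional_onD(2)[OF Mi(1) BM[OF A], of f c] by (simp add: mult.left_commute)
  qed
  have ind: "(\<integral>x. indicator A x * indicator C x \<partial>M) = measure M (A \<inter> C)"
    if "A \<in> sets (subspace_borel S)" "C \<in> sets (subspace_borel S)" for A C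
    using Mi(5)[of "A \<inter> C"] that by (simp flip: indicator_inter_arith)
  obtain P where P: "regular_prob_on S P" "\<And>f. f \<in> ?V \<Longrightarrow> (\<integral>x. f x \<partial>P) = (\<integral>x. indicator B x * f x \<partial>M) / m"
  proof (rule regular_representation[OF R R, of "\<lambda>f. (\<integral>x. indicator B x * f x \<partial>M) / m" "1 / m"])
    show "linear_functional_on ?V (\<lambda>f. (\<integral>x. indicator B x * f x \<partial>M) / m)"
      using lin[OF B] by (auto simp: linear_functional_on_def add_divide_distrib)
    show "0 \<le> (\<integral>x. indicator B x * f x \<partial>M) / m" if "\<And>x. x \<in> S \<Longrightarrow> 0 \<le> f x" for f
      using that m by (intro divide_nonneg_pos Mi(3)) auto
    show "(\<integral>x. indicator B x * 1 \<partial>M) / m = 1"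
      using Mi(5)[OF B] m by (simp add: m_def)
    show "(\<integral>x. indicator B x * indicator A x \<partial>M) / m \<le> 1 / m * (measure M A + measure M A)"
      if A: "A \<in> sets (subspace_borel S)" for A
    proof -
      have "measure M (B \<inter> A) \<le> measure M A"
        using A sM by (intro M.finite_measure_mono) auto
      then have "measure M (B \<inter> A) \<le> measure M A + measure M A"
        using measure_nonneg[of M A] by linarith
      then show ?thesis using m by (simp add: ind[OF B A] divide_right_mono)
    qed
  qed (use that in auto)
  have Pind: "measure P A = measure M (B \<inter> A) / m" if "A \<in> sets (subspace_borel S)" for A
    using P(2)[OF bounded_measurable_indicator[OF that]] ind[OF B that]
      regular_prob_integral(5)[OF P(1) that] by simp
  have "N = P" if N: "regular_prob_on S N" and le: "choquet_le S P N" for N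
  proof -
    note Ni = regular_prob_integral[OF N]
    have Bc: "S - B \<in> sets (subspace_borel S)"
      using sets.compl_sets[OF B] by simp
    \<comment> \<open>\<open>Q\<close> is \<open>M\<close> with its part on \<open>B\<close>, of
      mass \<open>m\<close>, replaced by \<open>m\<close> times \<open>N\<close>.\<close>
    obtain Q where Q: "regular_prob_on S Q"
      "\<And>f. f \<in> ?V \<Longrightarrow> (\<integral>x. f x \<partial>Q) = m * (\<integral>x. f x \<partial>N) + (\<integral>x. indicator (S - B) x * f x \<partial>M)"
    proof (rule regular_representation[OF N R,
          of "\<lambda>f. m * (\<integral>x. f x \<partial>N) + (\<integral>x. indicator (S - B) x * f x \<partial>M)" 1])
      show "linear_functional_on ?V (\<lambda>f. m * (\<integral>x. f x \<partial>N) + (\<integral>x. indicator (S - B) x * f x \<partial>M))"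
        using lin[OF Bc] Ni(1) by (auto simp: linear_functional_on_def algebra_simps)
      show "0 \<le> m * (\<integral>x. f x \<partial>N) + (\<integral>x. indicator (S - B) x * f x \<partial>M)"
        if "\<And>x. x \<in> S \<Longrightarrow> 0 \<le> f x" for f
        using that m by (intro add_nonneg_nonneg mult_nonneg_nonneg Mi(3) Ni(3)) auto
      have "measure M (S - B) = 1 - m"
        using M.prob_compl[of B] B sM space_regular_prob[OF R] by (simp add: m_def)
      then show "m * (\<integral>x. 1 \<partial>N) + (\<integral>x. indicator (S - B) x * 1 \<partial>M) = 1"
        unfolding mult_1_right Mi(5)[OF Bc] Ni(4) by simp
      show "m * (\<integral>x. indicator A x \<partial>N) + (\<integral>x. indicator (S - B) x * indicator A x \<partial>M)
          \<le> 1 * (measure N A + measure M A)" if A: "A \<in> sets (subspace_borel S)" for A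
      proof -
        have "measure M ((S - B) \<inter> A) \<le> measure M A"
          using A sM by (intro M.finite_measure_mono) auto
        moreover have "m * measure N A \<le> measure N A"
          using m by (intro mult_left_le_one_le) auto
        ultimately show ?thesis unfolding ind[OF Bc A] Ni(5)[OF A] by simp
      qed
    qed (use that in auto)
    have "choquet_le S M Q"
      unfolding choquet_le_def
    proof (intro allI impI)
      fix f assume f: "continuous_on S f \<and> convex_on S f"
      then have fV: "f \<in> ?V" using continuous_bounded_measurable[OF S] by simp
      have "(\<integral>x. f x \<partial>M) = (\<integral>x. indicator B x * f x + indicator (S - B) x * f x \<partial>M)"
        using space_regular_prob[OF R]
        by (intro Bochner_Integration.integral_cong) (auto simp: indicator_def)
      also have "\<dots> = m * (\<integral>x. f x \<partial>P) + (\<integral>x. indicator (S - B) x * f x \<partial>M)"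
        using linear_functional_onD(1)[OF Mi(1) BM[OF B fV] BM[OF Bc fV]] m
        by (simp add: P(2)[OF fV])
      also have "\<dots> \<le> (\<integral>x. f x \<partial>Q)"
        using le f m by (simp add: Q(2)[OF fV] choquet_le_def)
      finally show "(\<integral>x. f x \<partial>M) \<le> (\<integral>x. f x \<partial>Q)" .
    qed
    then have QM: "Q = M" using max Q(1) by blast
    show "N = P"
    proof (rule regular_prob_eqI[OF N P(1)])
      fix A assume A: "A \<in> sets (subspace_borel S)"
      have "measure M A = m * measure N A + measure M ((S - B) \<inter> A)"
        using Q(2)[OF bounded_measurable_indicator[OF A]] QM
        by (simp only: ind[OF Bc A] Mi(5)[OF A] Ni(5)[OF A])
      moreover have "measure M A = measure M (B \<inter> A) + measure M ((S - B) \<inter> A)"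
      proof -
        have "A = (B \<inter> A) \<union> ((S - B) \<inter> A)"
          using sets.sets_into_space[OF A] by auto
        then show ?thesis
          using A B Bc sM M.finite_measure_Union[of "B \<inter> A" "(S - B) \<inter> A"] by auto
      qed
      ultimately have "measure N A = measure P A"
        using m by (simp add: Pind[OF A] field_simps)
      then show "(\<integral>x. indicator A x \<partial>N) = (\<integral>x. indicator A x \<partial>P :: real)"
        by (simp only: Ni(5)[OF A] regular_prob_integral(5)[OF P(1) A])
    qed
  qed
  then have "maximal_prob_on S P" using P(1) by (simp add: maximal_prob_on_def)
  moreover have "measure P B = 1" using Pind[OF B] m by (simp add: m_def)
  ultimately show thesis by (rule that)
qed

section \<open>Affine functions and points of a simplex\<close>

lemma affine_functionsD:
  assumes "f \<in> affine_functions S"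
  shows "continuous_on S f"
    and "\<And>x y a b. x \<in> S \<Longrightarrow> y \<in> S \<Longrightarrow> 0 \<le> a \<Longrightarrow> 0 \<le> b \<Longrightarrow> a + b = 1 \<Longrightarrow>
      f (a *\<^sub>R x + b *\<^sub>R y) = a * f x + b * f y"
    and "\<And>x. x \<notin> S \<Longrightarrow> f x = 0"
proof -
  fix x y a b assume *: "x \<in> S" "y \<in> S" "0 \<le> a" "0 \<le> b" "a + b = (1::real)"
  then have "a = 1 - b" "b \<le> 1" by simp_all
  with * assms show "f (a *\<^sub>R x + b *\<^sub>R y) = a * f x + b * f y"
    by (simp add: affine_functions_def)
qed (use assms in \<open>auto simp: affine_functions_def\<close>)

lemma affine_functions_add:
  "f \<in> affine_functions S \<Longrightarrow> g \<in> affine_functions S \<Longrightarrow> (\<lambda>x. f x + g x) \<in> affine_functions S"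
  unfolding affine_functions_def
  by (auto intro!: continuous_intros simp: distrib_left)

lemma affine_functions_cmult:
  "f \<in> affine_functions S \<Longrightarrow> (\<lambda>x. c * f x) \<in> affine_functions S"
  unfolding affine_functions_def
  by (auto intro!: continuous_intros simp: distrib_left mult.left_commute)

text \<open>Elements of \<open>affine_functions S\<close> vanish off \<open>S\<close>, so this
  indicator is the order unit 1 of A(S).\<close>

lemma affine_functions_indicator: "convex S \<Longrightarrow> indicator S \<in> affine_functions S"
  by (auto simp: affine_functions_def convex_alt indicator_def cong: continuous_on_cong_simp)

lemma affine_functions_sum:
  assumes "convex S" "\<And>i. i \<in> I \<Longrightarrow> f i \<in> affine_functions S"
  shows "(\<lambda>x. \<Sum>i\<in>I. f i x) \<in> affine_functions S"
  using assms(2)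
proof (induction I rule: infinite_finite_induct)
  case (insert i I)
  then show ?case by (auto intro!: affine_functions_add)
qed (use affine_functions_cmult[OF affine_functions_indicator[OF assms(1)], of 0] in auto)

lemma linear_functional_affine_sum:
  assumes "convex S" and L: "linear_functional_on (affine_functions S) L"
    and "\<And>i. i \<in> I \<Longrightarrow> f i \<in> affine_functions S"
  shows "L (\<lambda>x. \<Sum>i\<in>I. c i * f i x) = (\<Sum>i\<in>I. c i * L (f i))"
  using assms(3)
proof (induction I rule: infinite_finite_induct)
  case (insert i I)
  have "L (\<lambda>x. c i * f i x + (\<Sum>i\<in>I. c i * f i x)) =
      L (\<lambda>x. c i * f i x) + L (\<lambda>x. \<Sum>i\<in>I. c i * f i x)"
    using insert.prems by (intro linear_functional_onD[OF L] affine_functions_cmult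
        affine_functions_sum \<open>convex S\<close>) auto
  with insert show ?case using linear_functional_onD(2)[OF L] by simp
qed (use linear_functional_onD(2)[OF L affine_functions_indicator[OF assms(1)], of 0] in auto)

text \<open>The point is found by least squares: at a minimiser of the sum of the squared errors over
  finitely many \<open>f\<close>, the first-order condition, applied to the combination of these \<open>f\<close> weighted by
  the errors, forces all errors to vanish. Compactness then handles all \<open>f\<close> at once.\<close>

lemma functional_attained:
  fixes S :: "'b::t2_locally_convex_space set" and K :: "'k::t2_space set"
    and g :: "('b \<Rightarrow> real) \<Rightarrow> 'k \<Rightarrow> real"
  assumes S: "convex S" and K: "compact K" "K \<noteq> {}"
    and \<phi>: "linear_functional_on (affine_functions S) \<phi>"
    and g: "\<And>k. k \<in> K \<Longrightarrow> linear_functional_on (affine_functions S) (\<lambda>f. g f k)"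
    and cont: "\<And>f. f \<in> affine_functions S \<Longrightarrow> continuous_on K (g f)"
    and mix: "\<And>k l t. k \<in> K \<Longrightarrow> l \<in> K \<Longrightarrow> 0 \<le> t \<Longrightarrow> t \<le> 1 \<Longrightarrow>
      \<exists>m\<in>K. \<forall>f\<in>affine_functions S. g f m = (1 - t) * g f k + t * g f l"
    and bound: "\<And>f. f \<in> affine_functions S \<Longrightarrow> \<exists>k\<in>K. \<phi> f \<le> g f k"
  shows "\<exists>k\<in>K. \<forall>f\<in>affine_functions S. \<phi> f = g f k"
proof -
  have fin: "\<exists>k\<in>K. \<forall>f\<in>F. \<phi> f = g f k" if F: "finite F" "F \<subseteq> affine_functions S" for F
  proof -
    have "continuous_on K (\<lambda>k. \<Sum>f\<in>F. (\<phi> f - g f k)\<^sup>2)"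
      using F cont by (auto intro!: continuous_intros)
    then obtain k0 where k0: "k0 \<in> K"
      and min: "\<And>k. k \<in> K \<Longrightarrow> (\<Sum>f\<in>F. (\<phi> f - g f k0)\<^sup>2) \<le> (\<Sum>f\<in>F. (\<phi> f - g f k)\<^sup>2)"
      using continuous_attains_inf[OF K] by blast
    define r where "r f = \<phi> f - g f k0" for f
    define h where "h x = (\<Sum>f\<in>F. r f * f x)" for x
    have hA: "h \<in> affine_functions S"
      unfolding h_def using F S by (auto intro!: affine_functions_sum affine_functions_cmult)
    then obtain k where k: "k \<in> K" "\<phi> h \<le> g h k" using bound by blast
    have \<phi>h: "\<phi> h = (\<Sum>f\<in>F. r f * \<phi> f)"
      unfolding h_def using F S \<phi> by (intro linear_functional_affine_sum) auto
    have gh: "g h l = (\<Sum>f\<in>F. r f * g f l)" if "l \<in> K" for l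
      unfolding h_def using F S g[OF that] by (intro linear_functional_affine_sum) auto
    define X where "X = (\<Sum>f\<in>F. r f * (g f k - g f k0))"
    define D where "D = (\<Sum>f\<in>F. (g f k - g f k0)\<^sup>2)"
    have "D \<ge> 0" unfolding D_def by (intro sum_nonneg) auto
    \<comment> \<open>The squared error is compared at \<open>k0\<close> and at the point a fraction
      \<open>t\<close> of the way towards \<open>k\<close>. Here \<open>X\<close> is the linear
      coefficient up to the factor -2, and \<open>D\<close> the quadratic one.\<close>
    have tX: "2 * t * X \<le> t\<^sup>2 * D" if t: "0 \<le> t" "t \<le> 1" for t
    proof -
      obtain m where m: "m \<in> K" "\<And>f. f \<in> affine_functions S \<Longrightarrow> g f m = (1 - t) * g f k0 + t * g f k"
        using mix[OF k0 k(1) t] by blast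
      have gm: "\<phi> f - g f m = r f - t * (g f k - g f k0)" if "f \<in> F" for f
        using m(2)[of f] F that by (auto simp: r_def algebra_simps)
      have "(\<Sum>f\<in>F. (r f)\<^sup>2) \<le> (\<Sum>f\<in>F. (\<phi> f - g f m)\<^sup>2)"
        using min[OF m(1)] by (simp add: r_def)
      also have "\<dots> = (\<Sum>f\<in>F. (r f)\<^sup>2 - 2 * t * (r f * (g f k - g f k0)) + t\<^sup>2 * (g f k - g f k0)\<^sup>2)"
        by (intro sum.cong) (simp_all add: gm power2_diff power_mult_distrib mult_ac)
      also have "\<dots> = (\<Sum>f\<in>F. (r f)\<^sup>2) - 2 * t * X + t\<^sup>2 * D"
        by (simp add: X_def D_def sum.distrib sum_subtractf sum_distrib_left)
      finally show ?thesis by simp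
    qed
    have "X \<le> 0"
    proof (rule ccontr)
      assume "\<not> X \<le> 0"
      then have X: "X > 0" by simp
      \<comment> \<open>This step size lies in the unit interval and satisfies
        \<open>t * D \<le> X\<close>, which contradicts \<open>2 * X \<le> t * D\<close>. Adding
        \<open>X\<close> to the denominator covers the case \<open>D = 0\<close>.\<close>
      define t where "t = X / (X + D)"
      have t: "0 < t" "t \<le> 1" using X \<open>D \<ge> 0\<close> by (simp_all add: t_def)
      have "t * (2 * X) \<le> t * (t * D)" using tX[of t] t by (simp add: power2_eq_square mult_ac)
      then have "2 * X \<le> t * D" using t by simp
      also have "t * D \<le> X" using X \<open>D \<ge> 0\<close> by (simp add: t_def field_simps)
      finally show False using X by simp
    qed
    \<comment> \<open>Since \<open>h\<close> is weighted by the errors and \<open>k\<close>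
      satisfies the bound for \<open>h\<close>, the total squared error is at most
      \<open>X\<close>.\<close>
    have "(\<Sum>f\<in>F. (r f)\<^sup>2) = \<phi> h - g h k0"
      unfolding \<phi>h gh[OF k0] by (simp add: r_def power2_eq_square right_diff_distrib sum_subtractf)
    also have "\<dots> \<le> g h k - g h k0" using k by simp
    also have "\<dots> = X"
      unfolding gh[OF k0] gh[OF k(1)] X_def by (simp add: right_diff_distrib sum_subtractf)
    finally have "(\<Sum>f\<in>F. (r f)\<^sup>2) \<le> 0" using \<open>X \<le> 0\<close> by simp
    then have "(\<Sum>f\<in>F. (r f)\<^sup>2) = 0" by (meson antisym sum_nonneg zero_le_power2)
    then have "\<forall>f\<in>F. r f = 0" using F by (simp add: sum_nonneg_eq_0_iff)
    with k0 show ?thesis by (auto simp: r_def)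
  qed
  define T where "T f = {k \<in> K. \<phi> f = g f k}" for f
  have "K \<inter> \<Inter> (T ` affine_functions S) \<noteq> {}"
  proof (rule compact_imp_fip[OF K(1)])
    fix A assume "A \<in> T ` affine_functions S"
    then obtain f where f: "f \<in> affine_functions S" "A = T f" by blast
    have "closed (K \<inter> g f -` {\<phi> f})"
      using cont[OF f(1)] compact_imp_closed[OF K(1)] by (rule continuous_closed_preimage) auto
    moreover have "A = K \<inter> g f -` {\<phi> f}" by (auto simp: f T_def)
    ultimately show "closed A" by simp
  next
    fix F' assume F': "finite F'" "F' \<subseteq> T ` affine_functions S"
    then obtain F where "F \<subseteq> affine_functions S" "finite F" "F' = T ` F"
      by (meson finite_subset_image)
    with fin[of F] show "K \<inter> \<Inter> F' \<noteq> {}" by (auto simp: T_def)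
  qed
  then show ?thesis by (auto simp: T_def)
qed

text \<open>Subtracting the midrange of \<open>f\<close> leaves a function whose norm is half the
  oscillation. This turns bounds by the norm into bounds by the extreme values \<open>f u\<close>
  and \<open>f v\<close>.\<close>

lemma affine_function_range:
  fixes S :: "'b::t2_locally_convex_space set"
  assumes S: "compact S" "convex S" "S \<noteq> {}" and f: "f \<in> affine_functions S"
  obtains u v where "u \<in> S" "v \<in> S"
    "sup_norm_on S (\<lambda>x. f x + (- ((f u + f v) / 2)) * indicator S x) \<le> (f u - f v) / 2"
proof -
  note cont = affine_functionsD(1)[OF f]
  obtain u where u: "u \<in> S" "\<And>x. x \<in> S \<Longrightarrow> f x \<le> f u"
    using continuous_attains_sup[OF S(1,3) cont] by blast
  obtain v where v: "v \<in> S" "\<And>x. x \<in> S \<Longrightarrow> f v \<le> f x"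
    using continuous_attains_inf[OF S(1,3) cont] by blast
  have "\<bar>f x + (- ((f u + f v) / 2)) * indicator S x\<bar> \<le> (f u - f v) / 2" if "x \<in> S" for x
    using u(2)[OF that] v(2)[OF that] that by (simp add: abs_le_iff field_simps)
  then have "sup_norm_on S (\<lambda>x. f x + (- ((f u + f v) / 2)) * indicator S x) \<le> (f u - f v) / 2"
    unfolding sup_norm_on_def using S(3) by (intro cSUP_least)
  with u(1) v(1) that show thesis by blast
qed

text \<open>Shifting \<open>f\<close> by its midrange changes both sides of the norm bound by known
  amounts, because the value at 1 is 1; the result is that the functional never exceeds the maximum
  of \<open>f\<close>, as \<open>functional_attained\<close> requires.\<close>

lemma state_eq_evaluation:
  fixes S :: "'b::t2_locally_convex_space set"
  assumes S: "compact S" "convex S" "S \<noteq> {}"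
    and \<phi>: "linear_functional_on (affine_functions S) \<phi>"
    and le: "\<And>f. f \<in> affine_functions S \<Longrightarrow> \<phi> f \<le> sup_norm_on S f"
    and one: "\<phi> (indicator S) = 1"
  shows "\<exists>s\<in>S. \<forall>f\<in>affine_functions S. \<phi> f = f s"
proof (rule functional_attained[OF S(2,1,3) \<phi>])
  note ind = affine_functions_indicator[OF S(2)]
  fix f assume f: "f \<in> affine_functions S"
  obtain u v where uv: "u \<in> S" "v \<in> S"
    "sup_norm_on S (\<lambda>x. f x + (- ((f u + f v) / 2)) * indicator S x) \<le> (f u - f v) / 2"
    by (rule affine_function_range[OF S f])
  define c where "c = - ((f u + f v) / 2)"
  have "\<phi> (\<lambda>x. f x + c * indicator S x) = \<phi> f + c * \<phi> (indicator S)"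
    by (simp only: linear_functional_onD[OF \<phi>] affine_functions_cmult f ind)
  moreover have "\<phi> (\<lambda>x. f x + c * indicator S x) \<le> (f u - f v) / 2"
    using le[OF affine_functions_add[OF f affine_functions_cmult[OF ind]], of c] uv(3)[folded c_def]
    by (rule order_trans)
  ultimately have "\<phi> f \<le> f u" using one by (simp add: c_def field_simps)
  with uv show "\<exists>k\<in>S. \<phi> f \<le> f k" by blast
next
  fix k l and t :: real assume *: "k \<in> S" "l \<in> S" "0 \<le> t" "t \<le> 1"
  show "\<exists>m\<in>S. \<forall>f\<in>affine_functions S. f m = (1 - t) * f k + t * f l"
    using * S(2) affine_functionsD(2)[of _ S k l "1 - t" t]
    by (intro bexI[of _ "(1 - t) *\<^sub>R k + t *\<^sub>R l"]) (auto simp: convex_alt)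
qed (auto simp: linear_functional_on_def affine_functionsD)

text \<open>Constants cancel in \<open>f s - f t\<close>, so the bound may be applied to
  \<open>f\<close> minus its midrange, whose norm is half the oscillation: hence
  \<open>d / 2\<close>. The pair \<open>(u, v)\<close> is then found by
  \<open>functional_attained\<close> on the compact set \<open>S \<times> S\<close>.\<close>

lemma evaluation_difference:
  fixes S :: "'b::t2_locally_convex_space set"
  assumes S: "compact S" "convex S" and st: "s \<in> S" "t \<in> S" and d: "d \<ge> 0"
    and le: "\<And>f. f \<in> affine_functions S \<Longrightarrow> f s - f t \<le> d * sup_norm_on S f"
  obtains u v where "u \<in> S" "v \<in> S"
    "\<And>f. f \<in> affine_functions S \<Longrightarrow> f s - f t = d / 2 * (f u - f v)"
proof -
  have ne: "S \<noteq> {}" using st by auto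
  have "\<exists>k\<in>S \<times> S. \<forall>f\<in>affine_functions S. f s - f t = d / 2 * (f (fst k) - f (snd k))"
  proof (rule functional_attained[OF S(2)])
    show "linear_functional_on (affine_functions S) (\<lambda>f. f s - f t)"
      by (auto simp: linear_functional_on_def algebra_simps)
    show "linear_functional_on (affine_functions S) (\<lambda>f. d / 2 * (f (fst k) - f (snd k)))" for k
      by (auto simp: linear_functional_on_def algebra_simps add_divide_distrib)
    show "continuous_on (S \<times> S) (\<lambda>k. d / 2 * (f (fst k) - f (snd k)))"
      if "f \<in> affine_functions S" for f
      using affine_functionsD(1)[OF that]
      by (auto intro!: continuous_intros continuous_on_compose2[of S f])
  next
    fix k l :: "'b \<times> 'b" and r :: real
    assume *: "k \<in> S \<times> S" "l \<in> S \<times> S" "0 \<le> r" "r \<le> 1"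
    let ?m = "((1 - r) *\<^sub>R fst k + r *\<^sub>R fst l, (1 - r) *\<^sub>R snd k + r *\<^sub>R snd l)"
    show "\<exists>m\<in>S \<times> S. \<forall>f\<in>affine_functions S. d / 2 * (f (fst m) - f (snd m)) =
        (1 - r) * (d / 2 * (f (fst k) - f (snd k))) + r * (d / 2 * (f (fst l) - f (snd l)))"
    proof (intro bexI[of _ ?m] ballI)
      fix f assume "f \<in> affine_functions S"
      then have eq: "f (fst ?m) = (1 - r) * f (fst k) + r * f (fst l)"
        "f (snd ?m) = (1 - r) * f (snd k) + r * f (snd l)"
        using * by (auto intro!: affine_functionsD(2))
      show "d / 2 * (f (fst ?m) - f (snd ?m)) =
        (1 - r) * (d / 2 * (f (fst k) - f (snd k))) + r * (d / 2 * (f (fst l) - f (snd l)))"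
        unfolding eq by (simp add: field_simps)
    qed (use * S(2) in \<open>auto simp: convex_alt\<close>)
  next
    fix f assume f: "f \<in> affine_functions S"
    note ind = affine_functions_indicator[OF S(2)]
    obtain u v where uv: "u \<in> S" "v \<in> S"
      "sup_norm_on S (\<lambda>x. f x + (- ((f u + f v) / 2)) * indicator S x) \<le> (f u - f v) / 2"
      by (rule affine_function_range[OF S ne f])
    have "f s - f t \<le> d * sup_norm_on S (\<lambda>x. f x + (- ((f u + f v) / 2)) * indicator S x)"
      using le[OF affine_functions_add[OF f affine_functions_cmult[OF ind]], of "- ((f u + f v) / 2)"] st
      by simp
    also have "\<dots> \<le> d * ((f u - f v) / 2)"
      using uv(3) d by (rule mult_left_mono)
    finally show "\<exists>k\<in>S \<times> S. f s - f t \<le> d / 2 * (f (fst k) - f (snd k))"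
      using uv by (intro bexI[of _ "(u, v)"]) auto
  qed (use S ne in \<open>auto intro: compact_Times\<close>)
  with that show thesis by auto
qed

section \<open>The maximal measure of a point of a simplex\<close>

definition maximal_measure :: "'b::t2_locally_convex_space set \<Rightarrow> 'b \<Rightarrow> 'b measure" where
  "maximal_measure S s = (THE M. maximal_prob_on S M \<and> represents_point S M s)"

context
  fixes S :: "'b::t2_locally_convex_space set"
  assumes simplex: "choquet_simplex S"
begin

lemma simplex_compact: "compact S" and simplex_convex: "convex S"
  using simplex by (auto simp: choquet_simplex_def)

lemma maximal_measure:
  assumes "s \<in> S"
  shows "maximal_prob_on S (maximal_measure S s)" "represents_point S (maximal_measure S s) s"
    and "regular_prob_on S (maximal_measure S s)"
proof -
  have "\<exists>!M. maximal_prob_on S M \<and> represents_point S M s"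
    using simplex assms by (auto simp: choquet_simplex_def)
  from theI'[OF this] show "maximal_prob_on S (maximal_measure S s)" "represents_point S (maximal_measure S s) s"
    by (simp_all add: maximal_measure_def)
  then show "regular_prob_on S (maximal_measure S s)" by (simp add: maximal_prob_on_def)
qed

lemma maximal_measure_eqI:
  assumes "s \<in> S" "maximal_prob_on S M" "\<And>f. f \<in> affine_functions S \<Longrightarrow> (\<integral>x. f x \<partial>M) = f s"
  shows "maximal_measure S s = M"
proof -
  have "\<exists>!M. maximal_prob_on S M \<and> represents_point S M s"
    using simplex assms(1) by (auto simp: choquet_simplex_def)
  then show ?thesis
    using maximal_measure[OF assms(1)] assms(2,3) by (auto simp: represents_point_def)
qed

lemma maximal_measure_integral:
  "s \<in> S \<Longrightarrow> f \<in> affine_functions S \<Longrightarrow> (\<integral>x. f x \<partial>maximal_measure S s) = f s"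
  using maximal_measure(2) by (simp add: represents_point_def)

text \<open>Points are compared through A(S) only: two points with equal evaluations are represented
  by the same measures, so they share the maximal one.\<close>

lemma maximal_measure_cong:
  assumes "s \<in> S" "t \<in> S" "\<And>f. f \<in> affine_functions S \<Longrightarrow> f s = f t"
  shows "maximal_measure S s = maximal_measure S t"
  by (rule maximal_measure_eqI[OF assms(1) maximal_measure(1)[OF assms(2)]])
    (metis maximal_measure_integral[OF assms(2)] assms(3))

lemma affine_bounded_measurable:
  "f \<in> affine_functions S \<Longrightarrow> f \<in> bounded_measurable (subspace_borel S)"
  using continuous_bounded_measurable[OF simplex_compact affine_functionsD(1)] by blast

text \<open>The mixture of the two maximal measures is maximal and represents \<open>w\<close>, so
  it is the measure of \<open>w\<close>. The point \<open>w\<close> is described by its evaluations,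
  which is all that is known about the points attached to functionals on \<open>X\<close>.\<close>

lemma maximal_measure_mixture:
  assumes st: "s \<in> S" "t \<in> S" "w \<in> S" and ab: "0 \<le> a" "0 \<le> b" "a + b = 1"
    and w: "\<And>f. f \<in> affine_functions S \<Longrightarrow> f w = a * f s + b * f t"
    and A: "A \<in> sets (subspace_borel S)"
  shows "measure (maximal_measure S w) A =
    a * measure (maximal_measure S s) A + b * measure (maximal_measure S t) A"
proof -
  \<comment> \<open>Splitting a dominating measure divides by both weights, so degenerate weights
    are treated apart.\<close>
  consider "a = 0" "b = 1" | "b = 0" "a = 1" | "0 < a" "0 < b" using ab by fastforce
  then show ?thesis
  proof cases
    case 1
    then have "maximal_measure S w = maximal_measure S t"
      using w by (intro maximal_measure_cong st) auto
    then show ?thesis using 1 by simp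
  next
    case 2
    then have "maximal_measure S w = maximal_measure S s"
      using w by (intro maximal_measure_cong st) auto
    then show ?thesis using 2 by simp
  next
    case 3
    obtain P where P: "maximal_prob_on S P"
      "\<And>f. f \<in> bounded_measurable (subspace_borel S) \<Longrightarrow> (\<integral>x. f x \<partial>P) =
        a * (\<integral>x. f x \<partial>maximal_measure S s) + b * (\<integral>x. f x \<partial>maximal_measure S t)"
      using maximal_prob_mixture[OF simplex_compact simplex_convex maximal_measure(1)[OF st(1)]
          maximal_measure(1)[OF st(2)] 3 ab(3)] by blast
    have wP: "maximal_measure S w = P"
      using st w P by (intro maximal_measure_eqI)
        (auto simp: affine_bounded_measurable maximal_measure_integral)
    have R: "regular_prob_on S P" using P by (simp add: maximal_prob_on_def)
    show ?thesis
      using P(2)[OF bounded_measurable_indicator[OF A]]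
      unfolding wP regular_prob_integral(5)[OF R A] regular_prob_integral(5)[OF maximal_measure(3)[OF st(1)] A]
        regular_prob_integral(5)[OF maximal_measure(3)[OF st(2)] A] .
  qed
qed

lemma sum_measure_disjoint_le_1:
  assumes M: "regular_prob_on S M" and B: "\<And>k. B k \<in> sets (subspace_borel S)" "disjoint_family B"
  shows "(\<Sum>k<(n::nat). measure M (B k)) \<le> 1"
proof -
  interpret prob_space M using M by (simp add: regular_prob_on_def)
  have "(\<Sum>k<n. measure M (B k)) = measure M (\<Union>k<n. B k)"
    using B sets_regular_prob[OF M]
    by (intro finite_measure_finite_Union[symmetric]) (auto simp: disjoint_family_on_def)
  then show ?thesis by simp
qed

text \<open>An identity between differences of points is moved to measures by making both sides
  convex combinations. Two probability measures differ by at most 2 in total variation, which turns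
  the factor \<open>d / 2\<close> into \<open>d\<close>.\<close>

lemma maximal_measure_nonexpansive:
  assumes st: "s \<in> S" "t \<in> S" and d: "d \<ge> 0"
    and le: "\<And>f. f \<in> affine_functions S \<Longrightarrow> f s - f t \<le> d * sup_norm_on S f"
    and B: "\<And>k. B k \<in> sets (subspace_borel S)" "disjoint_family B"
  shows "(\<Sum>k<(n::nat). \<bar>measure (maximal_measure S s) (B k) - measure (maximal_measure S t) (B k)\<bar>) \<le> d"
proof -
  define m where "m x k = measure (maximal_measure S x) (B k)" for x k
  obtain u v where uv: "u \<in> S" "v \<in> S"
    "\<And>f. f \<in> affine_functions S \<Longrightarrow> f s - f t = d / 2 * (f u - f v)"
    using evaluation_difference[OF simplex_compact simplex_convex st d le] by blast
  define a where "a = d / 2"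
  have a: "a \<ge> 0" using d by (simp add: a_def)
  \<comment> \<open>With \<open>a = d / 2\<close>, the identity
    \<open>f s + a * f v = f t + a * f u\<close>, divided by \<open>1 + a\<close>, presents the one
    point \<open>w\<close> as two mixtures.\<close>
  define w where "w = (1 / (1 + a)) *\<^sub>R s + (a / (1 + a)) *\<^sub>R v"
  have ab: "0 \<le> 1 / (1 + a)" "0 \<le> a / (1 + a)" "1 / (1 + a) + a / (1 + a) = 1"
    using a by (auto simp: field_simps)
  have w: "w \<in> S" unfolding w_def using st uv ab simplex_convex by (intro convexD)
  have fw: "f w = 1 / (1 + a) * f s + a / (1 + a) * f v" if "f \<in> affine_functions S" for f
    unfolding w_def using that st uv ab by (intro affine_functionsD(2))
  have fw': "f w = 1 / (1 + a) * f t + a / (1 + a) * f u" if "f \<in> affine_functions S" for f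
  proof -
    have "f s + a * f v = f t + a * f u"
      using uv(3)[OF that] by (simp add: a_def algebra_simps)
    then have "(f s + a * f v) / (1 + a) = (f t + a * f u) / (1 + a)"
      by simp
    then show ?thesis
      using fw[OF that] by (simp add: add_divide_distrib)
  qed
  have diff: "m s k - m t k = a * (m u k - m v k)" for k
  proof -
    have "1 / (1 + a) * m s k + a / (1 + a) * m v k = 1 / (1 + a) * m t k + a / (1 + a) * m u k"
      using maximal_measure_mixture[OF st(1) uv(2) w ab fw B(1)]
        maximal_measure_mixture[OF st(2) uv(1) w ab fw' B(1)] by (simp add: m_def)
    then have "(m s k + a * m v k) / (1 + a) = (m t k + a * m u k) / (1 + a)"
      by (simp add: add_divide_distrib)
    then show ?thesis using a by (simp add: algebra_simps)
  qed
  have "(\<Sum>k<n. \<bar>m s k - m t k\<bar>) = a * (\<Sum>k<n. \<bar>m u k - m v k\<bar>)"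
    using a by (simp add: diff abs_mult sum_distrib_left)
  also have "(\<Sum>k<n. \<bar>m u k - m v k\<bar>) \<le> (\<Sum>k<n. m u k + m v k)"
    by (intro sum_mono) (auto simp: m_def abs_le_iff intro: order_trans[OF _ measure_nonneg])
  also have "\<dots> \<le> 1 + 1"
    unfolding sum.distrib m_def
    using uv B by (intro add_mono sum_measure_disjoint_le_1 maximal_measure(3))
  finally have "(\<Sum>k<n. \<bar>m s k - m t k\<bar>) \<le> a * (1 + 1)" using a by (simp add: mult_left_mono)
  then show ?thesis by (simp add: m_def a_def)
qed

end

section \<open>Infinite Borel partitions of a simplex\<close>

text \<open>Finitely many jointly injective functionals bound the dimension. The induction passes to
  the kernel of one functional and adds a vector on which it does not vanish.\<close>

lemma finite_spanning_set:
  fixes W :: "('b \<Rightarrow> real) set"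
  assumes "finite I"
    and "\<And>f g. f \<in> W \<Longrightarrow> g \<in> W \<Longrightarrow> (\<lambda>x. f x + g x) \<in> W"
    and "\<And>c f. f \<in> W \<Longrightarrow> (\<lambda>x. c * f x) \<in> W"
    and "\<And>i. i \<in> I \<Longrightarrow> linear_functional_on W (L i)"
    and "\<And>f. f \<in> W \<Longrightarrow> (\<And>i. i \<in> I \<Longrightarrow> L i f = 0) \<Longrightarrow> f = (\<lambda>x. 0)"
  shows "\<exists>B. finite B \<and> B \<subseteq> W \<and> (\<forall>f\<in>W. \<exists>c. \<forall>x. f x = (\<Sum>b\<in>B. c b * b x))"
  using assms
proof (induction I arbitrary: W)
  case empty
  have "f x = 0" if "f \<in> W" for f x
    using fun_cong[OF empty(4)[OF that]] by simp
  then show ?case by (intro exI[of _ "{}"]) simp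
next
  case (insert i I W)
  note add = insert.prems(1) and scl = insert.prems(2) and lin = insert.prems(3) and inj = insert.prems(4)
  show ?case
  proof (cases "\<forall>f\<in>W. L i f = 0")
    case True
    have "f = (\<lambda>x. 0)" if "f \<in> W" "\<And>j. j \<in> I \<Longrightarrow> L j f = 0" for f
      using that True by (intro inj) auto
    with lin show ?thesis by (intro insert.IH add scl) blast+
  next
    case False
    then obtain v where v: "v \<in> W" "L i v \<noteq> 0" by blast
    have Li: "linear_functional_on W (L i)" using lin by simp
    define W' where "W' = {f \<in> W. L i f = 0}"
    have "\<exists>B. finite B \<and> B \<subseteq> W' \<and> (\<forall>f\<in>W'. \<exists>c. \<forall>x. f x = (\<Sum>b\<in>B. c b * b x))"
    proof (rule insert.IH)
      show "(\<lambda>x. f x + g x) \<in> W'" if "f \<in> W'" "g \<in> W'" for f g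
        using that add linear_functional_onD(1)[OF Li] by (simp add: W'_def)
      show "(\<lambda>x. c * f x) \<in> W'" if "f \<in> W'" for c f
        using that scl linear_functional_onD(2)[OF Li] by (simp add: W'_def)
      show "linear_functional_on W' (L j)" if "j \<in> I" for j
        using lin[of j] that by (simp add: W'_def linear_functional_on_def)
      show "f = (\<lambda>x. 0)" if "f \<in> W'" "\<And>j. j \<in> I \<Longrightarrow> L j f = 0" for f
        by (rule inj) (use that in \<open>auto simp: W'_def\<close>)
    qed
    then obtain B where B: "finite B" "B \<subseteq> W'"
      and span: "\<And>f. f \<in> W' \<Longrightarrow> \<exists>c. \<forall>x. f x = (\<Sum>b\<in>B. c b * b x)" by blast
    have vB: "v \<notin> B" using B v by (auto simp: W'_def)
    have "\<exists>c. \<forall>x. f x = (\<Sum>b\<in>insert v B. c b * b x)" if f: "f \<in> W" for f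
    proof -
      define k where "k = L i f / L i v"
      define g where "g x = f x + (- k) * v x" for x
      have "L i g = L i f + (- k) * L i v"
        unfolding g_def by (simp only: linear_functional_onD[OF Li] f v scl)
      moreover have "g \<in> W" unfolding g_def by (intro add scl f v)
      ultimately have "g \<in> W'" using v by (simp add: W'_def k_def)
      then obtain c where c: "\<And>x. g x = (\<Sum>b\<in>B. c b * b x)" using span by blast
      have "f x = (\<Sum>b\<in>insert v B. (c(v := k)) b * b x)" for x
      proof -
        have "(\<Sum>b\<in>B. (c(v := k)) b * b x) = (\<Sum>b\<in>B. c b * b x)"
          using vB by (intro sum.cong) auto
        then show ?thesis using vB B(1) c[of x] by (simp add: g_def)
      qed
      then show ?thesis by blast
    qed
    then show ?thesis
      using B v by (intro exI[of _ "insert v B"]) (auto simp: W'_def)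
  qed
qed

lemma abs_le_sup_norm_on:
  fixes f :: "'b::t2_space \<Rightarrow> real"
  assumes "compact S" "continuous_on S f" "x \<in> S"
  shows "\<bar>f x\<bar> \<le> sup_norm_on S f"
proof -
  have "compact ((\<lambda>x. \<bar>f x\<bar>) ` S)"
    using assms by (intro compact_continuous_image continuous_intros)
  then have "bdd_above ((\<lambda>x. \<bar>f x\<bar>) ` S)"
    by (intro bounded_imp_bdd_above compact_imp_bounded)
  then show ?thesis
    unfolding sup_norm_on_def using assms(3) by (rule cSUP_upper[rotated])
qed

section \<open>Cutting a simplex modulo sets null for all maximal measures\<close>

context
  fixes S :: "'b::t2_locally_convex_space set"
  assumes simplex: "choquet_simplex S"
begin

text \<open>The quantifier over all points replaces a single reference measure. Outside this
  sigma-ideal, a Borel set is charged by some \<open>maximal_measure\<close> and can be conditioned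
  on.\<close>

definition simplex_null :: "'b set \<Rightarrow> bool" where
  "simplex_null Z \<longleftrightarrow> Z \<in> sets (subspace_borel S) \<and> (\<forall>s\<in>S. Z \<in> null_sets (maximal_measure S s))"

lemma sets_maximal_measure: "s \<in> S \<Longrightarrow> sets (maximal_measure S s) = sets (subspace_borel S)"
  by (rule sets_regular_prob[OF maximal_measure(3)[OF simplex]])

lemma simplex_null_subset:
  "simplex_null Z \<Longrightarrow> A \<in> sets (subspace_borel S) \<Longrightarrow> A \<subseteq> Z \<Longrightarrow> simplex_null A"
  unfolding simplex_null_def using sets_maximal_measure by (blast intro: null_sets_subset)

lemma simplex_null_UN:
  assumes "countable I" "\<And>i. i \<in> I \<Longrightarrow> simplex_null (Z i)"
  shows "simplex_null (\<Union>i\<in>I. Z i)"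
  unfolding simplex_null_def
proof (intro conjI ballI)
  show "(\<Union>i\<in>I. Z i) \<in> sets (subspace_borel S)"
    using assms by (intro sets.countable_UN') (auto simp: simplex_null_def)
  show "(\<Union>i\<in>I. Z i) \<in> null_sets (maximal_measure S s)" if "s \<in> S" for s
    using assms that by (intro null_sets_UN') (auto simp: simplex_null_def)
qed

lemma simplex_null_Un: "simplex_null A \<Longrightarrow> simplex_null B \<Longrightarrow> simplex_null (A \<union> B)"
  by (auto simp: simplex_null_def)

lemma simplex_null_empty: "simplex_null {}"
  by (simp add: simplex_null_def)

lemma level_sets:
  assumes A: "A \<in> sets (subspace_borel S)" and f: "f \<in> bounded_measurable (subspace_borel S)"
  shows "{x \<in> A. f x \<le> t} \<in> sets (subspace_borel S)" "{x \<in> A. t < f x} \<in> sets (subspace_borel S)"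
    "{x \<in> A. f x \<noteq> t} \<in> sets (subspace_borel S)"
proof -
  note [measurable] = bounded_measurable_measurable[OF f] A
  have "A \<subseteq> S" using sets.sets_into_space[OF A] by simp
  then have eq: "{x \<in> A. f x \<le> t} = A \<inter> {x \<in> space (subspace_borel S). f x \<le> t}"
    "{x \<in> A. t < f x} = A \<inter> {x \<in> space (subspace_borel S). t < f x}"
    "{x \<in> A. f x \<noteq> t} = A \<inter> {x \<in> space (subspace_borel S). f x \<noteq> t}" by auto
  show "{x \<in> A. f x \<le> t} \<in> sets (subspace_borel S)" "{x \<in> A. t < f x} \<in> sets (subspace_borel S)"
    "{x \<in> A. f x \<noteq> t} \<in> sets (subspace_borel S)"
    unfolding eq by measurable
qed

text \<open>If at every threshold one of the two sides were null, then \<open>f\<close> would equal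
  the critical threshold \<open>c = Sup T\<close> off countably many null sets.\<close>

lemma nonconstant_threshold:
  assumes A: "A \<in> sets (subspace_borel S)" and f: "f \<in> bounded_measurable (subspace_borel S)"
    and nc: "\<And>c. \<not> simplex_null {x \<in> A. f x \<noteq> c}"
  shows "\<exists>t. \<not> simplex_null {x \<in> A. f x \<le> t} \<and> \<not> simplex_null {x \<in> A. t < f x}"
proof (rule ccontr)
  assume "\<not> ?thesis"
  then have alt: "simplex_null {x \<in> A. f x \<le> t} \<or> simplex_null {x \<in> A. t < f x}" for t by blast
  note lev = level_sets[OF A f]
  have AS: "A \<subseteq> S" using sets.sets_into_space[OF A] by simp
  obtain C where C: "\<And>x. x \<in> S \<Longrightarrow> \<bar>f x\<bar> \<le> C"
    using bounded_measurable_bound[OF f] by auto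
  \<comment> \<open>\<open>T\<close> contains \<open>- C - 1\<close>, where the lower side is empty,
    and nothing above \<open>C\<close>, since there the lower side is all of
    \<open>A\<close>.\<close>
  define T where "T = {t. simplex_null {x \<in> A. f x \<le> t}}"
  have "\<not> f x \<le> - C - 1" if "x \<in> A" for x
    using C[of x] that AS by (auto simp: abs_le_iff)
  then have "{x \<in> A. f x \<le> - C - 1} = {}" by auto
  then have "- C - 1 \<in> T" by (simp only: T_def mem_Collect_eq simplex_null_empty)
  have Tle: "t \<le> C" if "t \<in> T" for t
  proof (rule ccontr)
    assume "\<not> t \<le> C"
    have "f x \<le> t" if "x \<in> A" for x
      using C[of x] that AS \<open>\<not> t \<le> C\<close> by (auto simp: abs_le_iff)
    then have "{x \<in> A. f x \<noteq> 0} \<subseteq> {x \<in> A. f x \<le> t}" by auto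
    with that nc[of 0] lev(3) show False
      by (auto simp: T_def dest: simplex_null_subset)
  qed
  then have bdd: "bdd_above T" by (rule bdd_aboveI)
  define c where "c = Sup T"
  have below: "simplex_null {x \<in> A. f x \<le> c - 1 / real (Suc n)}" for n
  proof -
    have "c - 1 / real (Suc n) < Sup T" by (simp add: c_def)
    then obtain t where t: "t \<in> T" "c - 1 / real (Suc n) < t"
      using less_cSup_iff[OF _ bdd] \<open>- C - 1 \<in> T\<close> by blast
    then have "simplex_null {x \<in> A. f x \<le> t}" by (simp add: T_def)
    then show ?thesis
      using t(2) by (rule_tac simplex_null_subset[OF _ lev(1)]) auto
  qed
  have above: "simplex_null {x \<in> A. c + 1 / real (Suc n) < f x}" for n
  proof -
    have "c + 1 / real (Suc n) \<notin> T"
    proof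
      assume "c + 1 / real (Suc n) \<in> T"
      from cSup_upper[OF this bdd] show False by (simp add: c_def field_simps)
    qed
    with alt show ?thesis by (auto simp: T_def)
  qed
  have "simplex_null ((\<Union>n. {x \<in> A. f x \<le> c - 1 / real (Suc n)}) \<union> (\<Union>n. {x \<in> A. c + 1 / real (Suc n) < f x}))"
    by (intro simplex_null_Un simplex_null_UN below above) auto
  moreover have "{x \<in> A. f x \<noteq> c} \<subseteq>
      (\<Union>n. {x \<in> A. f x \<le> c - 1 / real (Suc n)}) \<union> (\<Union>n. {x \<in> A. c + 1 / real (Suc n) < f x})"
  proof
    fix x assume x: "x \<in> {x \<in> A. f x \<noteq> c}"
    then have "\<bar>f x - c\<bar> > 0" by simp
    then obtain n where n: "1 / real (Suc n) < \<bar>f x - c\<bar>"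
      using nat_approx_posE by blast
    show "x \<in> (\<Union>n. {x \<in> A. f x \<le> c - 1 / real (Suc n)}) \<union> (\<Union>n. {x \<in> A. c + 1 / real (Suc n) < f x})"
    proof (cases "f x < c")
      case True
      with n have "f x \<le> c - 1 / real (Suc n)" by linarith
      with x show ?thesis by blast
    next
      case False
      with n have "c + 1 / real (Suc n) < f x" by linarith
      with x show ?thesis by blast
    qed
  qed
  ultimately have "simplex_null {x \<in> A. f x \<noteq> c}"
    using lev(3) by (rule_tac simplex_null_subset)
  with nc show False by blast
qed

text \<open>Atoms relative to A(S) rather than to a measure: no affine function can cut such a set
  into two non-null level sets. Null Borel sets count as atoms, and the exceptional null set may
  depend on \<open>f\<close>.\<close>

definition simplex_atom :: "'b set \<Rightarrow> bool" where
  "simplex_atom A \<longleftrightarrow> A \<in> sets (subspace_borel S) \<and>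
     (\<forall>f\<in>affine_functions S. \<exists>c. simplex_null {x \<in> A. f x \<noteq> c})"

definition finitely_atomic :: "'b set \<Rightarrow> bool" where
  "finitely_atomic A \<longleftrightarrow> (\<exists>F. finite F \<and> (\<forall>a\<in>F. simplex_atom a) \<and> A = \<Union>F)"

lemma finitely_atomic_Un:
  assumes "finitely_atomic A" "finitely_atomic B" shows "finitely_atomic (A \<union> B)"
proof -
  obtain F G where "finite F" "\<forall>a\<in>F. simplex_atom a" "A = \<Union>F" "finite G" "\<forall>a\<in>G. simplex_atom a" "B = \<Union>G"
    using assms unfolding finitely_atomic_def by blast
  then show ?thesis
    unfolding finitely_atomic_def by (intro exI[of _ "F \<union> G"]) auto
qed

text \<open>A set that is not an atom is cut into two non-null pieces by a threshold. They cannot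
  both be finitely atomic, so a piece that is not is kept and the other is split off; the invariant
  lets the cutting go on forever.\<close>

lemma split_not_finitely_atomic:
  assumes A: "A \<in> sets (subspace_borel S)" "\<not> finitely_atomic A"
  shows "\<exists>A'. (A' \<in> sets (subspace_borel S) \<and> \<not> finitely_atomic A') \<and> A' \<subseteq> A \<and> \<not> simplex_null (A - A')"
proof -
  have "\<not> simplex_atom A"
    using A(2) unfolding finitely_atomic_def by (auto dest: spec[of _ "{A}"])
  then obtain f where f: "f \<in> affine_functions S" "\<And>c. \<not> simplex_null {x \<in> A. f x \<noteq> c}"
    using A(1) by (auto simp: simplex_atom_def)
  note fb = affine_bounded_measurable[OF simplex f(1)]
  obtain t where t: "\<not> simplex_null {x \<in> A. f x \<le> t}" "\<not> simplex_null {x \<in> A. t < f x}"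
    using nonconstant_threshold[OF A(1) fb f(2)] by blast
  have eq: "A - {x \<in> A. f x \<le> t} = {x \<in> A. t < f x}" "A - {x \<in> A. t < f x} = {x \<in> A. f x \<le> t}"
    "{x \<in> A. f x \<le> t} \<union> {x \<in> A. t < f x} = A" by auto
  consider "\<not> finitely_atomic {x \<in> A. f x \<le> t}" | "\<not> finitely_atomic {x \<in> A. t < f x}"
    using finitely_atomic_Un[of "{x \<in> A. f x \<le> t}" "{x \<in> A. t < f x}"] A(2) eq(3) by auto
  then show ?thesis
  proof cases
    case 1
    with t level_sets[OF A(1) fb] eq show ?thesis by (intro exI[of _ "{x \<in> A. f x \<le> t}"]) auto
  next
    case 2
    with t level_sets[OF A(1) fb] eq show ?thesis by (intro exI[of _ "{x \<in> A. t < f x}"]) auto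
  qed
qed

text \<open>The constants taken on the non-null atoms are linear functionals of \<open>f\<close>. If
  all of them vanish, then \<open>f\<close> is zero almost everywhere for every maximal measure, and
  \<open>f s\<close> is the integral of \<open>f\<close> against that of \<open>s\<close>.\<close>

lemma finite_dim_if_finitely_atomic:
  assumes "finitely_atomic S"
  shows "finite_dim_affine_functions S"
proof -
  obtain F where F: "finite F" "\<And>a. a \<in> F \<Longrightarrow> simplex_atom a" "S = \<Union>F"
    using assms unfolding finitely_atomic_def by blast
  define I where "I = {a \<in> F. \<not> simplex_null a}"
  define L where "L a f = (SOME c. simplex_null {x \<in> a. f x \<noteq> c})" for a and f :: "'b \<Rightarrow> real"
  have aS: "a \<in> sets (subspace_borel S)" if "a \<in> F" for a
    using F(2)[OF that] by (simp add: simplex_atom_def)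
  have Lnull: "simplex_null {x \<in> a. f x \<noteq> L a f}" if "a \<in> F" "f \<in> affine_functions S" for a f
    unfolding L_def by (rule someI_ex) (use F(2)[OF that(1)] that(2) in \<open>auto simp: simplex_atom_def\<close>)
  \<comment> \<open>On a non-null atom the constant is unique, since two different ones would cover
    the atom by two null sets. Linearity of \<open>L a\<close> follows from this.\<close>
  have Leq: "L a f = c" if "a \<in> I" "f \<in> affine_functions S" "simplex_null Z" "{x \<in> a. f x \<noteq> c} \<subseteq> Z" for a f c Z
  proof (rule ccontr)
    assume "L a f \<noteq> c"
    then have "a \<subseteq> {x \<in> a. f x \<noteq> L a f} \<union> Z" using that(4) by auto
    with that have "simplex_null a"
      by (intro simplex_null_subset[OF simplex_null_Un[OF Lnull that(3)] aS]) (auto simp: I_def)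
    with that(1) show False by (simp add: I_def)
  qed
  have "\<exists>B. finite B \<and> B \<subseteq> affine_functions S \<and>
      (\<forall>f\<in>affine_functions S. \<exists>c. \<forall>x. f x = (\<Sum>b\<in>B. c b * b x))"
  proof (rule finite_spanning_set[of I])
    show "finite I" using F by (simp add: I_def)
    show "linear_functional_on (affine_functions S) (L a)" if a: "a \<in> I" for a
      unfolding linear_functional_on_def
    proof (intro conjI ballI allI)
      have aF: "a \<in> F" using a by (simp add: I_def)
      fix f assume f: "f \<in> affine_functions S"
      show "L a (\<lambda>x. f x + g x) = L a f + L a g" if g: "g \<in> affine_functions S" for g
        by (rule Leq[OF a affine_functions_add[OF f g] simplex_null_Un[OF Lnull[OF aF f] Lnull[OF aF g]]]) auto
      show "L a (\<lambda>x. c * f x) = c * L a f" for c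
        by (rule Leq[OF a affine_functions_cmult[OF f] Lnull[OF aF f]]) auto
    qed
  next
    fix f assume f: "f \<in> affine_functions S" and 0: "\<And>a. a \<in> I \<Longrightarrow> L a f = 0"
    have N: "simplex_null (\<Union>a\<in>F. {x \<in> a. f x \<noteq> 0})"
    proof (rule simplex_null_UN)
      fix a assume a: "a \<in> F"
      show "simplex_null {x \<in> a. f x \<noteq> 0}"
      proof (cases "a \<in> I")
        case True
        then show ?thesis using Lnull[OF a f] 0 by simp
      next
        case False
        then have "simplex_null a" using a by (simp add: I_def)
        then show ?thesis
          by (rule simplex_null_subset[OF _ level_sets(3)[OF aS[OF a] affine_bounded_measurable[OF simplex f]]]) auto
      qed
    qed (use F in \<open>simp add: countable_finite\<close>)
    show "f = (\<lambda>x. 0)"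
    proof
      fix x show "f x = 0"
      proof (cases "x \<in> S")
        case True
        let ?M = "maximal_measure S x"
        have "AE y in ?M. f y = 0"
        proof (rule AE_I')
          show "(\<Union>a\<in>F. {x \<in> a. f x \<noteq> 0}) \<in> null_sets ?M"
            using N True by (simp add: simplex_null_def)
          show "{y \<in> space ?M. f y \<noteq> 0} \<subseteq> (\<Union>a\<in>F. {x \<in> a. f x \<noteq> 0})"
            unfolding space_regular_prob[OF maximal_measure(3)[OF simplex True]] using F(3) by auto
        qed
        then have "(\<integral>y. f y \<partial>?M) = 0" by (rule integral_eq_zero_AE)
        then show ?thesis using maximal_measure_integral[OF simplex True f] by simp
      qed (use affine_functionsD(3)[OF f] in auto)
    qed
  qed (auto intro: affine_functions_add affine_functions_cmult)
  then show ?thesis by (simp add: finite_dim_affine_functions_def)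
qed

lemma infinite_borel_partition:
  assumes "\<not> finite_dim_affine_functions S"
  obtains B :: "nat \<Rightarrow> 'b set" where "\<And>k. B k \<in> sets (subspace_borel S)" "disjoint_family B"
    "(\<Union>k. B k) = S" "\<And>k. \<not> simplex_null (B k)"
proof -
  have SB: "S \<in> sets (subspace_borel S)"
    using sets.top[of "subspace_borel S"] by simp
  have "\<not> finitely_atomic S"
    using assms finite_dim_if_finitely_atomic by blast
  with SB obtain A :: "nat \<Rightarrow> 'b set" where
    A: "\<And>n. A n \<in> sets (subspace_borel S)" "\<And>n. A (Suc n) \<subseteq> A n" "\<And>n. \<not> simplex_null (A n - A (Suc n))"
    using dependent_nat_choice[of "\<lambda>_ A. A \<in> sets (subspace_borel S) \<and> \<not> finitely_atomic A"
        "\<lambda>_ A A'. A' \<subseteq> A \<and> \<not> simplex_null (A - A')"] split_not_finitely_atomic by metis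
  define D where "D n = A n - A (Suc n)" for n
  define R where "R = S - (\<Union>n. D n)"
  \<comment> \<open>The remainder \<open>R\<close> may be null, so it is absorbed by the first piece
    instead of forming a piece of its own.\<close>
  define B where "B k = (if k = 0 then D 0 \<union> R else D k)" for k
  have dec: "A n \<subseteq> A m" if "m \<le> n" for m n
    using that A(2) by (rule lift_Suc_antimono_le[of A, rotated])
  have D_disj: "D m \<inter> D n = {}" if "m < n" for m n
    using dec[of "Suc m" n] that by (auto simp: D_def)
  have Ds: "D n \<in> sets (subspace_borel S)" for n using A(1) by (auto simp: D_def)
  have Rs: "R \<in> sets (subspace_borel S)" using SB Ds by (auto simp: R_def)
  show thesis
  proof (rule that[of B])
    show Bs: "B k \<in> sets (subspace_borel S)" for k using Ds Rs by (auto simp: B_def)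
    have "B m \<inter> B n = {}" if "m < n" for m n
      using D_disj[OF that] that by (auto simp: B_def R_def)
    then show "disjoint_family B"
      unfolding disjoint_family_on_def by (metis Int_commute linorder_neqE_nat)
    show "(\<Union>k. B k) = S"
    proof
      show "(\<Union>k. B k) \<subseteq> S" using sets.sets_into_space[OF Bs] by auto
      show "S \<subseteq> (\<Union>k. B k)"
      proof
        fix x assume x: "x \<in> S"
        show "x \<in> (\<Union>k. B k)"
        proof (cases "x \<in> R")
          case True
          then have "x \<in> B 0" by (simp add: B_def)
          then show ?thesis by blast
        next
          case False
          then obtain n where "x \<in> D n" using x by (auto simp: R_def)
          then have "x \<in> B n" by (cases n) (simp_all add: B_def)
          then show ?thesis by blast
        qed
      qed
    qed
    show "\<not> simplex_null (B k)" for k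
    proof
      assume "simplex_null (B k)"
      then have "simplex_null (D k)"
        by (rule simplex_null_subset[OF _ Ds]) (auto simp: B_def)
      then show False using A(3)[of k] by (simp add: D_def)
    qed
  qed
qed

text \<open>Some maximal measure charges \<open>B\<close>. Conditioned on \<open>B\<close> it stays
  maximal, integration against it is a state, hence evaluation at a point \<open>e\<close>, and by
  uniqueness it is the measure of \<open>e\<close>.\<close>

lemma concentrated_point:
  assumes B: "B \<in> sets (subspace_borel S)" and nn: "\<not> simplex_null B"
  shows "\<exists>e\<in>S. measure (maximal_measure S e) B = 1"
proof -
  obtain s where s: "s \<in> S" "B \<notin> null_sets (maximal_measure S s)"
    using B nn by (auto simp: simplex_null_def)
  interpret M: prob_space "maximal_measure S s"
    using maximal_measure(3)[OF simplex s(1)] by (simp add: regular_prob_on_def)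
  have "measure (maximal_measure S s) B > 0"
    using s(2) B sets_maximal_measure[OF s(1)]
    by (auto simp: null_sets_def M.emeasure_eq_measure zero_less_measure_iff)
  then obtain P where P: "maximal_prob_on S P" "measure P B = 1"
    using maximal_prob_conditional[OF simplex_compact[OF simplex] maximal_measure(1)[OF simplex s(1)] B] by blast
  have R: "regular_prob_on S P" using P by (simp add: maximal_prob_on_def)
  note Pi = regular_prob_integral[OF R]
  have ne: "S \<noteq> {}" using s by auto
  have "\<exists>e\<in>S. \<forall>f\<in>affine_functions S. (\<integral>x. f x \<partial>P) = f e"
  proof (rule state_eq_evaluation[OF simplex_compact[OF simplex] simplex_convex[OF simplex] ne])
    show "linear_functional_on (affine_functions S) (\<lambda>f. \<integral>x. f x \<partial>P)"
      using Pi(1) affine_bounded_measurable[OF simplex] by (simp add: linear_functional_on_def)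
  next
    fix f assume f: "f \<in> affine_functions S"
    note fb = affine_bounded_measurable[OF simplex f]
    have "f x \<le> sup_norm_on S f" if "x \<in> S" for x
      using abs_le_sup_norm_on[OF simplex_compact[OF simplex] affine_functionsD(1)[OF f] that] by simp
    then have "(\<integral>x. f x \<partial>P) \<le> (\<integral>x. sup_norm_on S f \<partial>P)"
      by (intro Pi(2) fb bounded_measurable_const)
    then show "(\<integral>x. f x \<partial>P) \<le> sup_norm_on S f" unfolding Pi(4) .
  next
    interpret P: prob_space P using R by (simp add: regular_prob_on_def)
    show "(\<integral>x. indicator S x \<partial>P) = (1::real)"
      using P.prob_space space_regular_prob[OF R] by simp
  qed
  then obtain e where e: "e \<in> S" "\<And>f. f \<in> affine_functions S \<Longrightarrow> (\<integral>x. f x \<partial>P) = f e" by blast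
  have "maximal_measure S e = P" by (rule maximal_measure_eqI[OF simplex e(1) P(1) e(2)])
  with P e show ?thesis by blast
qed

end

section \<open>A fixed-point-free map on a weak-star compact set\<close>

text \<open>Banach-Alaoglu with one more closed condition: linearity and the value at
  \<open>v\<close> cut a closed set out of a product of intervals, and \<open>Blinfun\<close>
  carries it continuously onto the slice.\<close>

lemma compact_dual_unit_ball_slice:
  fixes v :: "'a::real_normed_vector"
  shows "compactin weak_star_topology {x :: 'a \<Rightarrow>\<^sub>L real. norm x \<le> 1 \<and> blinfun_apply x v = r}"
proof -
  define K where "K = (\<Pi>\<^sub>E a\<in>UNIV. cball (0::real) (norm (a::'a)))"
  define L where "L = K \<inter> ((\<Inter>a. \<Inter>b. {g. g (a + b) = g a + g b}) \<inter>
    (\<Inter>c. \<Inter>a. {g. g (c *\<^sub>R a) = c * g a}) \<inter> {g. g v = r})"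
  have "compactin (product_topology (\<lambda>_. euclidean) UNIV) K"
    unfolding K_def by (simp add: compactin_PiE)
  then have "compact K"
    by (simp add: euclidean_product_topology)
  moreover have "closed ((\<Inter>a. \<Inter>b. {g :: 'a \<Rightarrow> real. g (a + b) = g a + g b}) \<inter>
    (\<Inter>c. \<Inter>a. {g. g (c *\<^sub>R a) = c * g a}) \<inter> {g. g v = r})"
    by (intro closed_Int closed_INT ballI closed_Collect_eq continuous_intros
        continuous_on_product_coordinates)
  ultimately have "compact L"
    unfolding L_def by (rule compact_Int_closed)
  have bl: "bounded_linear g" if "g \<in> L" for g
  proof (rule bounded_linear_intro[of _ 1])
    show "norm (g a) \<le> norm a * 1" for a
      using that by (auto simp: L_def K_def PiE_iff)
  qed (use that in \<open>auto simp: L_def\<close>)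
  have "continuous_map (subtopology euclidean L) weak_star_topology Blinfun"
    unfolding continuous_on_strong_operator_topo_iff_coordinatewise
  proof
    fix a :: 'a
    have "continuous_map (subtopology euclidean L) euclidean (\<lambda>g. g a)"
      by (intro continuous_map_from_subtopology) simp
    then show "continuous_map (subtopology euclidean L) euclidean (\<lambda>g. blinfun_apply (Blinfun g) a)"
      by (rule continuous_map_eq) (use bl in \<open>auto simp: bounded_linear_Blinfun_apply\<close>)
  qed
  moreover have "compactin (subtopology euclidean L) L"
    using \<open>compact L\<close> by simp
  ultimately have "compactin weak_star_topology (Blinfun ` L)"
    by (rule image_compactin[rotated])
  moreover have "Blinfun ` L = {x :: 'a \<Rightarrow>\<^sub>L real. norm x \<le> 1 \<and> blinfun_apply x v = r}"
  proof (intro antisym subsetI)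
    fix x assume "x \<in> Blinfun ` L"
    then obtain g where g: "g \<in> L" "x = Blinfun g" by blast
    have "norm (blinfun_apply x a) \<le> 1 * norm a" for a
      using g by (auto simp: bounded_linear_Blinfun_apply[OF bl[OF g(1)]] L_def K_def PiE_iff)
    then have "norm x \<le> 1" by (intro norm_blinfun_bound) auto
    with g show "x \<in> {x. norm x \<le> 1 \<and> blinfun_apply x v = r}"
      by (simp add: bounded_linear_Blinfun_apply[OF bl[OF g(1)]]) (simp add: L_def)
  next
    fix x :: "'a \<Rightarrow>\<^sub>L real" assume x: "x \<in> {x. norm x \<le> 1 \<and> blinfun_apply x v = r}"
    have "norm (blinfun_apply x a) \<le> norm a" for a
      using norm_blinfun[of x a] x mult_right_mono[of "norm x" 1 "norm a"] by simp
    with x have "blinfun_apply x \<in> L"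
      by (auto simp: L_def K_def blinfun.add_right blinfun.scaleR_right)
    moreover have "x = Blinfun (blinfun_apply x)" by (simp add: blinfun_apply_inverse)
    ultimately show "x \<in> Blinfun ` L" by (metis image_eqI)
  qed
  ultimately show ?thesis by simp
qed

section \<open>Functionals that restrict to states on a copy of A(S)\<close>

locale affine_function_embedding =
  fixes S :: "'b::t2_locally_convex_space set" and J :: "('b \<Rightarrow> real) \<Rightarrow> 'a::real_normed_vector"
  assumes S: "choquet_simplex S" "S \<noteq> {}"
    and J_add: "\<And>f g. f \<in> affine_functions S \<Longrightarrow> g \<in> affine_functions S \<Longrightarrow> J (\<lambda>x. f x + g x) = J f + J g"
    and J_scl: "\<And>c f. f \<in> affine_functions S \<Longrightarrow> J (\<lambda>x. c * f x) = c *\<^sub>R J f"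
    and J_norm: "\<And>f. f \<in> affine_functions S \<Longrightarrow> norm (J f) = sup_norm_on S f"
begin

text \<open>The value 1 at the unit vector \<open>J (indicator S)\<close> forces norm one. Written
  as a slice of the unit ball, the set is weak-star compact and convex at once.\<close>

definition states :: "('a \<Rightarrow>\<^sub>L real) set" where
  "states = {x. norm x \<le> 1 \<and> blinfun_apply x (J (indicator S)) = 1}"

lemma one_affine: "indicator S \<in> affine_functions S"
  by (rule affine_functions_indicator[OF simplex_convex[OF S(1)]])

lemma abs_le_norm_J: "f \<in> affine_functions S \<Longrightarrow> s \<in> S \<Longrightarrow> \<bar>f s\<bar> \<le> norm (J f)"
  using abs_le_sup_norm_on[OF simplex_compact[OF S(1)] affine_functionsD(1)] by (simp add: J_norm)

text \<open>The cone \<open>G\<close> is the graph of evaluation at \<open>s\<close> on the copy of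
  A(S). As \<open>G\<close> is closed under negation, its one-sided constraints force
  equality.\<close>

lemma evaluation_extends:
  assumes s: "s \<in> S"
  shows "\<exists>x\<in>states. \<forall>f\<in>affine_functions S. blinfun_apply x (J f) = f s"
proof -
  define G where "G = {(J f, f s) | f. f \<in> affine_functions S}"
  have vs: "vector_space (scaleR :: real \<Rightarrow> 'a \<Rightarrow> 'a)"
    by (rule real_vector.vector_space_axioms)
  have sub: "module.subspace (scaleR :: real \<Rightarrow> 'a \<Rightarrow> 'a) UNIV"
    unfolding subspace_raw_def[symmetric] by (rule subspace_UNIV)
  have J0: "(0, 0) \<in> G"
    using J_scl[OF one_affine, of 0] affine_functions_cmult[OF one_affine, of 0]
    unfolding G_def by (intro CollectI exI[of _ "\<lambda>x. 0 * indicator S x"]) simp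
  have "\<exists>\<phi>. (\<forall>x y. \<phi> (x + y) = \<phi> x + \<phi> y) \<and> (\<forall>c x. \<phi> (c *\<^sub>R x) = c * \<phi> x) \<and>
      (\<forall>x. \<phi> x \<le> norm x) \<and> (\<forall>v r. (v, r) \<in> G \<longrightarrow> r \<le> \<phi> v)"
  proof (rule hahn_banach_cone[where p = norm and G = G, OF vs sub])
    show "(v + w, r + t) \<in> G" if vw: "(v, r) \<in> G" "(w, t) \<in> G" for v r w t
    proof -
      obtain f where "f \<in> affine_functions S" "v = J f" "r = f s"
        using vw(1) by (auto simp: G_def)
      moreover obtain g where "g \<in> affine_functions S" "w = J g" "t = g s"
        using vw(2) by (auto simp: G_def)
      ultimately show ?thesis unfolding G_def
        by (intro CollectI exI[of _ "\<lambda>x. f x + g x"]) (simp add: J_add affine_functions_add)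
    qed
    show "(c *\<^sub>R v, c * r) \<in> G" if vr: "(v, r) \<in> G" for c v r
    proof -
      obtain f where "f \<in> affine_functions S" "v = J f" "r = f s"
        using vr by (auto simp: G_def)
      then show ?thesis unfolding G_def
        by (intro CollectI exI[of _ "\<lambda>x. c * f x"]) (simp add: J_scl affine_functions_cmult)
    qed
    show "r \<le> norm v" if "(v, r) \<in> G" for v r
      using that abs_le_norm_J[OF _ s] by (fastforce simp: G_def abs_le_iff)
  qed (auto simp: J0 norm_triangle_ineq)
  then obtain \<phi> where \<phi>: "\<And>x y. \<phi> (x + y) = \<phi> x + \<phi> y" "\<And>c x. \<phi> (c *\<^sub>R x) = c * \<phi> x"
    "\<And>x. \<phi> x \<le> norm x" "\<And>v r. (v, r) \<in> G \<Longrightarrow> r \<le> \<phi> v" by blast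
  have le: "norm (\<phi> x) \<le> 1 * norm x" for x
    using \<phi>(2)[of "-1" x] \<phi>(3)[of x] \<phi>(3)[of "- x"] by (simp add: abs_le_iff)
  then have bl: "bounded_linear \<phi>"
    using \<phi>(1,2) by (intro bounded_linear_intro[of _ 1]) auto
  have nrm: "norm (Blinfun \<phi>) \<le> 1"
    using le by (intro norm_blinfun_bound) (simp_all add: bounded_linear_Blinfun_apply[OF bl])
  have eq: "\<phi> (J f) = f s" if f: "f \<in> affine_functions S" for f
  proof (rule antisym)
    have "(J f, f s) \<in> G" "(J (\<lambda>x. - 1 * f x), - 1 * f s) \<in> G"
      using f affine_functions_cmult[OF f, of "-1"] unfolding G_def by blast+
    then show "f s \<le> \<phi> (J f)" "\<phi> (J f) \<le> f s"
      using \<phi>(4) \<phi>(2)[of "-1" "J f"] J_scl[OF f, of "-1"] by fastforce+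
  qed
  have "Blinfun \<phi> \<in> states"
    using nrm eq[OF one_affine] s by (simp add: states_def bounded_linear_Blinfun_apply[OF bl])
  with eq show ?thesis
    by (intro bexI[of _ "Blinfun \<phi>"]) (auto simp: bounded_linear_Blinfun_apply[OF bl])
qed

lemma restriction_of_state:
  assumes "x \<in> states"
  shows "\<exists>s\<in>S. \<forall>f\<in>affine_functions S. blinfun_apply x (J f) = f s"
proof (rule state_eq_evaluation[OF simplex_compact[OF S(1)] simplex_convex[OF S(1)] S(2)])
  show "linear_functional_on (affine_functions S) (\<lambda>f. blinfun_apply x (J f))"
    by (simp add: linear_functional_on_def J_add J_scl blinfun.add_right blinfun.scaleR_right)
  show "blinfun_apply x (J f) \<le> sup_norm_on S f" if f: "f \<in> affine_functions S" for f
  proof -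
    have "blinfun_apply x (J f) \<le> norm x * norm (J f)"
      using norm_blinfun[of x "J f"] by simp
    also have "\<dots> \<le> 1 * norm (J f)"
      using assms by (intro mult_right_mono) (auto simp: states_def)
    finally show ?thesis by (simp add: J_norm[OF f])
  qed
qed (use assms in \<open>simp add: states_def\<close>)

text \<open>The choice is immaterial: all candidates agree on A(S), so
  \<open>maximal_measure\<close> takes the same value at each of them.\<close>

definition point :: "('a \<Rightarrow>\<^sub>L real) \<Rightarrow> 'b" where
  "point x = (SOME s. s \<in> S \<and> (\<forall>f\<in>affine_functions S. blinfun_apply x (J f) = f s))"

lemma point:
  assumes "x \<in> states"
  shows "point x \<in> S" "\<And>f. f \<in> affine_functions S \<Longrightarrow> f (point x) = blinfun_apply x (J f)"
  using someI_ex[OF restriction_of_state[OF assms, unfolded Bex_def]] unfolding point_def by auto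

lemma convex_states: "convex states"
proof (rule convexI)
  fix x y and u v :: real assume *: "x \<in> states" "y \<in> states" "0 \<le> u" "0 \<le> v" "u + v = 1"
  have "norm (u *\<^sub>R x + v *\<^sub>R y) \<le> u * norm x + v * norm y"
    using * norm_triangle_ineq[of "u *\<^sub>R x" "v *\<^sub>R y"] by simp
  also have "\<dots> \<le> u * 1 + v * 1"
    using * by (intro add_mono mult_left_mono) (auto simp: states_def)
  finally show "u *\<^sub>R x + v *\<^sub>R y \<in> states"
    using * by (simp add: states_def blinfun.add_left blinfun.scaleR_left)
qed

text \<open>The total weight \<open>W\<close> is kept general: it is 1 when the map is defined, and
  \<open>1 - c\<close> for the rest of a series from which one term has been removed.\<close>

lemma weighted_states:
  assumes E: "\<And>k. E k \<in> states" and w: "\<And>k. 0 \<le> w k" "w sums W"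
  obtains z where "(\<lambda>k. w k *\<^sub>R E k) sums z" "norm z \<le> W" "blinfun_apply z (J (indicator S)) = W"
proof -
  have le: "norm (w k *\<^sub>R E k) \<le> w k" for k
    using E[of k] w(1)[of k] by (simp add: states_def mult_left_le)
  have "summable (\<lambda>k. w k *\<^sub>R E k)"
    by (rule summable_comparison_test'[OF sums_summable[OF w(2)] le])
  then obtain z where z: "(\<lambda>k. w k *\<^sub>R E k) sums z" by (auto simp: summable_def)
  have "norm z \<le> W" by (rule norm_sums_le[OF z w(2) le])
  moreover have "(\<lambda>k. blinfun_apply (w k *\<^sub>R E k) (J (indicator S))) sums blinfun_apply z (J (indicator S))"
    using z by (rule bounded_linear.sums[OF blinfun.bounded_linear_left])
  then have "w sums blinfun_apply z (J (indicator S))"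
    using E by (simp add: states_def blinfun.scaleR_left)
  then have "blinfun_apply z (J (indicator S)) = W"
    using w(2) by (rule sums_unique2)
  ultimately show thesis using z that by blast
qed

lemma fixed_point_free_map:
  assumes inf: "\<not> finite_dim_affine_functions S"
  obtains T where "T ` states \<subseteq> states" "nonexpansive_on states T" "\<And>x. x \<in> states \<Longrightarrow> T x \<noteq> x"
proof -
  obtain B :: "nat \<Rightarrow> 'b set" where B: "\<And>k. B k \<in> sets (subspace_borel S)" "disjoint_family B"
    "(\<Union>k. B k) = S" "\<And>k. \<not> simplex_null S (B k)"
    using infinite_borel_partition[OF S(1) inf] by blast
  obtain e where e: "\<And>k. e k \<in> S" "\<And>k. measure (maximal_measure S (e k)) (B k) = 1"
    using concentrated_point[OF S(1) B(1) B(4)] by metis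
  obtain E where E: "\<And>k. E k \<in> states" "\<And>k f. f \<in> affine_functions S \<Longrightarrow> blinfun_apply (E k) (J f) = f (e k)"
    using evaluation_extends[OF e(1)] by metis
  define m where "m x k = measure (maximal_measure S (point x)) (B k)" for x k
  have m_nn: "0 \<le> m x k" for x k by (simp add: m_def)
  have m_sums: "m x sums 1" if "x \<in> states" for x
  proof -
    have R: "regular_prob_on S (maximal_measure S (point x))"
      using maximal_measure(3)[OF S(1)] point(1)[OF that] by blast
    interpret prob_space "maximal_measure S (point x)"
      using R by (simp add: regular_prob_on_def)
    have "(\<lambda>k. m x k) sums measure (maximal_measure S (point x)) (\<Union>k. B k)"
      unfolding m_def using B(1,2) sets_regular_prob[OF R] by (intro finite_measure_UNION) auto
    then show ?thesis using prob_space space_regular_prob[OF R] by (simp add: B(3))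
  qed
  have mE: "m (E k) k = 1" for k
  proof -
    have "maximal_measure S (point (E k)) = maximal_measure S (e k)"
      using point[OF E(1)] E(2) e(1) by (intro maximal_measure_cong[OF S(1)]) auto
    then show ?thesis using e(2) by (simp add: m_def)
  qed
  \<comment> \<open>The successor is the shift: the mass found on piece \<open>k\<close> is sent to
    the state concentrated on piece \<open>k + 1\<close>.\<close>
  define T where "T x = (\<Sum>k. m x k *\<^sub>R E (Suc k))" for x
  have T_sums: "(\<lambda>k. m x k *\<^sub>R E (Suc k)) sums T x" and T_state: "T x \<in> states" if x: "x \<in> states" for x
  proof -
    obtain z where z: "(\<lambda>k. m x k *\<^sub>R E (Suc k)) sums z" "norm z \<le> 1" "blinfun_apply z (J (indicator S)) = 1"
      by (rule weighted_states[of "\<lambda>k. E (Suc k)", OF E(1) m_nn m_sums[OF x]])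
    then show "(\<lambda>k. m x k *\<^sub>R E (Suc k)) sums T x" "T x \<in> states"
      using sums_unique[OF z(1)] by (simp_all add: T_def states_def)
  qed
  show thesis
  proof (rule that)
    show "T ` states \<subseteq> states" using T_state by blast
    show "nonexpansive_on states T"
      unfolding nonexpansive_on_def
    proof (intro ballI)
      fix x y assume xy: "x \<in> states" "y \<in> states"
      have le: "(\<Sum>k<n. \<bar>m x k - m y k\<bar>) \<le> norm (x - y)" for n
        unfolding m_def
      proof (rule maximal_measure_nonexpansive[OF S(1) point(1)[OF xy(1)] point(1)[OF xy(2)] _ _ B(1,2)])
        fix f assume f: "f \<in> affine_functions S"
        have "f (point x) - f (point y) = blinfun_apply (x - y) (J f)"
          using f xy by (simp add: point(2) blinfun.diff_left)
        also have "\<dots> \<le> norm (x - y) * norm (J f)"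
          using norm_blinfun[of "x - y" "J f"] by simp
        finally show "f (point x) - f (point y) \<le> norm (x - y) * sup_norm_on S f"
          by (simp add: J_norm[OF f])
      qed simp
      have smb: "summable (\<lambda>k. \<bar>m x k - m y k\<bar>)"
        by (rule bounded_imp_summable[where B = "norm (x - y)"])
          (use le[of "Suc _"] in \<open>simp_all add: lessThan_Suc_atMost\<close>)
      have "norm (T x - T y) \<le> (\<Sum>k. \<bar>m x k - m y k\<bar>)"
      proof (rule norm_sums_le)
        show "(\<lambda>k. m x k *\<^sub>R E (Suc k) - m y k *\<^sub>R E (Suc k)) sums (T x - T y)"
          by (intro sums_diff T_sums xy)
        show "(\<lambda>k. \<bar>m x k - m y k\<bar>) sums (\<Sum>k. \<bar>m x k - m y k\<bar>)"
          using smb by (rule summable_sums)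
        show "norm (m x k *\<^sub>R E (Suc k) - m y k *\<^sub>R E (Suc k)) \<le> \<bar>m x k - m y k\<bar>" for k
          using E(1)[of "Suc k"] by (simp add: states_def mult_left_le flip: scaleR_diff_left)
      qed
      also have "\<dots> \<le> norm (x - y)"
        using smb le by (rule suminf_le_const)
      finally show "norm (T x - T y) \<le> norm (x - y)" .
    qed
    show "T x \<noteq> x" if x: "x \<in> states" for x
    proof
      assume Tx: "T x = x"
      \<comment> \<open>Only the term with \<open>E (Suc k)\<close> is separated from the series for
        \<open>x = T x\<close>; the rest is \<open>1 - c\<close> times a state \<open>y\<close>.
        Affinity for two points gives \<open>m x (Suc k)\<close> at least \<open>c\<close> times 1,
        and \<open>c = m x k\<close>.\<close>
      have step: "m x k \<le> m x (Suc k)" for k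
      proof -
        define c where "c = m x k"
        define w where "w i = (if i = k then 0 else m x i)" for i
        have w_eq: "w = (\<lambda>i. m x i - (if i = k then m x i else 0))"
          by (auto simp: w_def)
        have w: "w sums (1 - c)"
          unfolding w_eq c_def by (intro sums_diff m_sums[OF x] sums_single)
        have w_nn: "0 \<le> w i" for i by (simp add: w_def m_nn)
        obtain z where z: "(\<lambda>i. w i *\<^sub>R E (Suc i)) sums z" "norm z \<le> 1 - c"
          "blinfun_apply z (J (indicator S)) = 1 - c"
          by (rule weighted_states[of "\<lambda>k. E (Suc k)", OF E(1) w_nn w])
        have "(\<lambda>i. (if i = k then m x i *\<^sub>R E (Suc i) else 0) + w i *\<^sub>R E (Suc i)) sums (m x k *\<^sub>R E (Suc k) + z)"
          by (intro sums_add sums_single z(1))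
        moreover have "(\<lambda>i. (if i = k then m x i *\<^sub>R E (Suc i) else 0) + w i *\<^sub>R E (Suc i)) = (\<lambda>i. m x i *\<^sub>R E (Suc i))"
          by (auto simp: w_def)
        ultimately have xz: "x = c *\<^sub>R E (Suc k) + z"
          using T_sums[OF x] Tx by (simp add: c_def sums_unique2)
        have c: "0 \<le> c" "c \<le> 1"
          using m_nn z(2) norm_ge_zero[of z] by (auto simp: c_def simp del: norm_ge_zero)
        show ?thesis
        \<comment> \<open>If \<open>c = 1\<close> the rest has norm 0 and cannot be normalised, but
          then \<open>x\<close> is \<open>E (Suc k)\<close> itself.\<close>
        proof (cases "c = 1")
          case True
          then have "z = 0" using z(2) by simp
          with xz True have "x = E (Suc k)" by simp
          then show ?thesis using mE True by (simp add: c_def)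
        next
          case False
          then have c1: "0 < 1 - c" using c by simp
          define y where "y = (1 / (1 - c)) *\<^sub>R z"
          have y: "y \<in> states"
            using z c1 by (simp add: states_def y_def blinfun.scaleR_left)
          have xy: "x = c *\<^sub>R E (Suc k) + (1 - c) *\<^sub>R y"
            using c1 by (simp add: xz y_def)
          have "f (point x) = c * f (point (E (Suc k))) + (1 - c) * f (point y)"
            if f: "f \<in> affine_functions S" for f
          proof -
            have "blinfun_apply x (J f) = c * blinfun_apply (E (Suc k)) (J f) + (1 - c) * blinfun_apply y (J f)"
              by (subst xy) (simp add: blinfun.add_left blinfun.scaleR_left)
            then show ?thesis by (simp only: point(2)[OF x f] point(2)[OF E(1) f] point(2)[OF y f])
          qed
          then have "m x (Suc k) = c * m (E (Suc k)) (Suc k) + (1 - c) * m y (Suc k)"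
            unfolding m_def using c
            by (intro maximal_measure_mixture[OF S(1)] point(1) E(1) x y B(1)) auto
          then show ?thesis
            using mE c1 m_nn[of y "Suc k"] by (simp add: c_def)
        qed
      qed
      \<comment> \<open>A nondecreasing sequence lies below its limit, and the terms of a convergent
        series tend to 0.\<close>
      have "m x k \<le> 0" for k
        by (rule incseq_le[OF _ summable_LIMSEQ_zero])
          (use step in \<open>simp add: incseq_Suc_iff\<close>, rule sums_summable[OF m_sums[OF x]])
      with m_nn have "m x = (\<lambda>k. 0)" by (intro ext antisym)
      with m_sums[OF x] show False by (simp add: sums_iff)
    qed
  qed
qed

lemma not_weak_star_fpp:
  assumes "\<not> finite_dim_affine_functions S"
  shows "\<not> weak_star_fpp TYPE('a)"
proof -
  obtain T where T: "T ` states \<subseteq> states" "nonexpansive_on states T" "\<And>x. x \<in> states \<Longrightarrow> T x \<noteq> x"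
    using fixed_point_free_map[OF assms] by blast
  obtain s where "s \<in> S" using S(2) by blast
  then have "states \<noteq> {}" using evaluation_extends by blast
  moreover have "compactin weak_star_topology states"
    unfolding states_def by (rule compact_dual_unit_ball_slice)
  ultimately show ?thesis
    unfolding weak_star_fpp_def using T convex_states by blast
qed

end

theorem theorem2p3:
  fixes S :: "'b::t2_locally_convex_space set"
    and Y :: "'a::banach set"
  assumes "separable_space (euclidean :: 'a topology)"
    and "choquet_simplex S"
    and "\<not> finite_dim_affine_functions S"
    and "subspace Y"
    and "isometric_to_affine_functions Y S"
  shows "\<not> weak_star_fpp TYPE('a)"
proof -
  \<comment> \<open>Over the empty set the zero function is the only element, and the empty family
    spans it.\<close>
  have ne: "S \<noteq> {}"
  proof
    assume "S = {}"
    then have "finite_dim_affine_functions S"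
      by (auto simp: finite_dim_affine_functions_def affine_functions_def intro!: exI[of _ "{}"])
    with assms(3) show False by blast
  qed
  obtain J where
    "\<And>f g. f \<in> affine_functions S \<Longrightarrow> g \<in> affine_functions S \<Longrightarrow> J (\<lambda>x. f x + g x) = (J f + J g :: 'a)"
    "\<And>c f. f \<in> affine_functions S \<Longrightarrow> J (\<lambda>x. c * f x) = c *\<^sub>R J f"
    "\<And>f. f \<in> affine_functions S \<Longrightarrow> norm (J f) = sup_norm_on S f"
    using assms(5) unfolding isometric_to_affine_functions_def by blast
  then interpret affine_function_embedding S J
    using assms(2) ne by unfold_locales
  show ?thesis by (rule not_weak_star_fpp[OF assms(3)])
qed

end
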